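(* Let $d\ge 2$, let $C=\prod_{i=1}^d[l_i,u_i]\subset\mathbb{R}^d$, let $M>0$, and let $f:C\to\mathbb{R}$ have a global minimizer $x^*\in C$ such that $$f(x)-f(x^* )=\left(\frac{M}{2}+\delta(x)\right)\|x-x^*\|^2\quad\text{with}\quad |\delta(x)|\le\Delta=\frac{M}{16(d-1)}\qquad\text{for all }x\in C,$$ where $\|\cdot\|$ is the Euclidean norm. Then the Direction BBS algorithm (described in the context) requires $\mathcal{O}\left(\log_{3/2}(1/\varepsilon)\right)$ outer iterations (as $\varepsilon\to 0$) to find a solution, i.e. to reach a box $\prod_j[b_j,B_j]$ containing $x^*$ with $\|B-b\|<2\varepsilon$; and the oracle complexity (number of evaluations of $f$) of each outer iteration is $\mathcal{O}(d)$. Here the constant in the first bound may depend on $d$ and the initial box $C$ but not on $\varepsilon$ or $f$, and the constant in the second bound is absolute.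
   Context: Direction BBS algorithm with accuracy $\varepsilon>0$. Set $n:=15$ and initialize $b:=l=(l_1,\dots,l_d)$, $B:=u=(u_1,\dots,u_d)$, $m:=\frac{l+u}{2}\in\mathbb{R}^d$. The current box is $\prod_{j=1}^d[b_j,B_j]$. While $\|B-b\|\ge2\varepsilon$, the algorithm performs an outer iteration; one outer iteration consists of performing, for $i=1,\dots,d$ in this order, the following inner step (always with the current values of $b,B,m$): 1. $R:=\max_{k\in\{1,\dots,d\}}(B_k-b_k)$. 2. $j^*\in\arg\min_{j\in\{0,\dots,n\}} f\left(m_1,\dots,m_{i-1},\ b_i+j\frac{B_i-b_i}{n},\ m_{i+1},\dots,m_d\right)$ (ties broken arbitrarily). 3. $m_i:=b_i+j^*\frac{B_i-b_i}{n}$. 4. $b_i:=\max\left(b_i,\ m_i-\frac{R}{3}\right)$ and $B_i:=\min\left(B_i,\ m_i+\frac{R}{3}\right)$. The algorithm only uses values of $f$; the function $\delta$ is otherwise arbitrary (no continuity is assumed). *)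

theory Defs
  imports "HOL-Analysis.Analysis" "HOL-Library.Landau_Symbols"
begin

text \<open>
  The dimension \<open>d\<close> must be an ordinary natural number, since one of the constants of the theorem
  does not depend on it. A point of \<open>d\<close>-dimensional Euclidean space is therefore a function
  \<open>nat \<Rightarrow> real\<close> that is \<open>undefined\<close> outside \<open>{..<d}\<close>; coordinates are numbered from \<open>0\<close>.
\<close>

definition hyperbox :: "nat \<Rightarrow> (nat \<Rightarrow> real) \<Rightarrow> (nat \<Rightarrow> real) \<Rightarrow> (nat \<Rightarrow> real) set" where
  "hyperbox d l u = (\<Pi>\<^sub>E j\<in>{..<d}. {l j..u j})"

definition eucl_dist :: "nat \<Rightarrow> (nat \<Rightarrow> real) \<Rightarrow> (nat \<Rightarrow> real) \<Rightarrow> real" where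
  "eucl_dist d x y = L2_set (\<lambda>j. x j - y j) {..<d}"

record bbs_state =
  lower :: "nat \<Rightarrow> real"
  upper :: "nat \<Rightarrow> real"
  point :: "nat \<Rightarrow> real"

definition bbs_init :: "nat \<Rightarrow> (nat \<Rightarrow> real) \<Rightarrow> (nat \<Rightarrow> real) \<Rightarrow> bbs_state" where
  "bbs_init d l u =
     \<lparr>lower = l, upper = u, point = (\<lambda>j\<in>{..<d}. (l j + u j) / 2)\<rparr>"

definition grid_size :: nat where
  "grid_size = 15"

definition grid_coord :: "bbs_state \<Rightarrow> nat \<Rightarrow> nat \<Rightarrow> real" where
  "grid_coord s i j = lower s i + real j * ((upper s i - lower s i) / real grid_size)"

definition max_side :: "nat \<Rightarrow> bbs_state \<Rightarrow> real" where
  "max_side d s = Max ((\<lambda>k. upper s k - lower s k) ` {..<d})"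

definition bbs_queries :: "nat \<Rightarrow> bbs_state \<Rightarrow> (nat \<Rightarrow> real) list" where
  "bbs_queries i s = map (\<lambda>j. (point s)(i := grid_coord s i j)) [0..<Suc grid_size]"

definition bbs_update :: "nat \<Rightarrow> nat \<Rightarrow> nat \<Rightarrow> bbs_state \<Rightarrow> bbs_state" where
  "bbs_update d i j s =
     (let R = max_side d s; t = grid_coord s i j in
      \<lparr>lower = (lower s)(i := max (lower s i) (t - R / 3)),
       upper = (upper s)(i := min (upper s i) (t + R / 3)),
       point = (point s)(i := t)\<rparr>)"

text \<open>
  The relations below are indexed by the list \<open>qs\<close> of all points at which \<open>f\<close> is evaluated, with
  repetitions; \<open>f\<close> enters only through its values at these points. They are relations and not
  functions because any minimising grid index may be chosen.
\<close>

inductive bbs_inner ::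
  "nat \<Rightarrow> ((nat \<Rightarrow> real) \<Rightarrow> real) \<Rightarrow> nat \<Rightarrow> bbs_state \<Rightarrow> (nat \<Rightarrow> real) list \<Rightarrow> bbs_state \<Rightarrow> bool"
  for d f where
  "qs = bbs_queries i s \<Longrightarrow>
   is_arg_min (\<lambda>j. f (qs ! j)) (\<lambda>j. j \<in> {0..grid_size}) j \<Longrightarrow>
   bbs_inner d f i s qs (bbs_update d i j s)"

inductive bbs_steps ::
  "nat \<Rightarrow> ((nat \<Rightarrow> real) \<Rightarrow> real) \<Rightarrow> nat list \<Rightarrow> bbs_state \<Rightarrow> (nat \<Rightarrow> real) list \<Rightarrow> bbs_state \<Rightarrow> bool"
  for d f where
  "bbs_steps d f [] s [] s"
| "bbs_inner d f i s qs s' \<Longrightarrow> bbs_steps d f is s' qs' s'' \<Longrightarrow>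
   bbs_steps d f (i # is) s (qs @ qs') s''"

definition bbs_outer ::
  "nat \<Rightarrow> ((nat \<Rightarrow> real) \<Rightarrow> real) \<Rightarrow> bbs_state \<Rightarrow> (nat \<Rightarrow> real) list \<Rightarrow> bbs_state \<Rightarrow> bool" where
  "bbs_outer d f s qs s' \<longleftrightarrow> bbs_steps d f [0..<d] s qs s'"

definition bbs_continues :: "nat \<Rightarrow> real \<Rightarrow> bbs_state \<Rightarrow> bool" where
  "bbs_continues d \<epsilon> s \<longleftrightarrow> eucl_dist d (upper s) (lower s) \<ge> 2 * \<epsilon>"

text \<open>
  \<open>\<sigma> k\<close> is the state after \<open>k\<close> outer iterations and \<open>Q k\<close> lists the points evaluated in the
  iteration leading from \<open>\<sigma> k\<close> to \<open>\<sigma> (Suc k)\<close>; once the loop is left, the run stutters.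
\<close>

definition bbs_run ::
  "nat \<Rightarrow> ((nat \<Rightarrow> real) \<Rightarrow> real) \<Rightarrow> (nat \<Rightarrow> real) \<Rightarrow> (nat \<Rightarrow> real) \<Rightarrow> real \<Rightarrow>
   (nat \<Rightarrow> bbs_state) \<Rightarrow> (nat \<Rightarrow> (nat \<Rightarrow> real) list) \<Rightarrow> bool" where
  "bbs_run d f l u \<epsilon> \<sigma> Q \<longleftrightarrow>
     \<sigma> 0 = bbs_init d l u \<and>
     (\<forall>k. if bbs_continues d \<epsilon> (\<sigma> k) then bbs_outer d f (\<sigma> k) (Q k) (\<sigma> (Suc k))
          else \<sigma> (Suc k) = \<sigma> k \<and> Q k = [])"

lemma bbs_inner_exists: "\<exists>qs s'. bbs_inner d f i s qs s'"
proof -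
  have "\<exists>j. is_arg_min (\<lambda>j. f (bbs_queries i s ! j)) (\<lambda>j. j \<in> {0..grid_size}) j"
    using ex_is_arg_min_if_finite[of "{0..grid_size}" "\<lambda>j. f (bbs_queries i s ! j)"] by simp
  then show ?thesis
    using bbs_inner.intros by blast
qed

lemma bbs_steps_exists: "\<exists>qs s'. bbs_steps d f is s qs s'"
proof (induction "is" arbitrary: s)
  case Nil
  then show ?case
    using bbs_steps.intros(1) by blast
next
  case (Cons i "is")
  then show ?case
    using bbs_inner_exists[of d f i s] bbs_steps.intros(2) by blast
qed

lemma bbs_run_exists: "\<exists>\<sigma> Q. bbs_run d f l u \<epsilon> \<sigma> Q"
proof -
  let ?P = "\<lambda>s qs s'. if bbs_continues d \<epsilon> s then bbs_outer d f s qs s' else s' = s \<and> qs = []"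
  have "\<forall>s. \<exists>qs s'. ?P s qs s'"
    unfolding bbs_outer_def using bbs_steps_exists by (metis (full_types))
  then obtain q g where step: "\<And>s. ?P s (q s) (g s)"
    by metis
  let ?\<sigma> = "\<lambda>k. (g ^^ k) (bbs_init d l u)"
  have "bbs_run d f l u \<epsilon> ?\<sigma> (\<lambda>k. q (?\<sigma> k))"
    unfolding bbs_run_def using step by simp
  then show ?thesis
    by blast
qed

end

theory Submission
  imports Defs
begin

text \<open>
  Put \<open>D = d - 1\<close>, let \<open>R\<close> be the longest side of the current box and suppose that the box contains
  the minimizer. In a step on coordinate \<open>i\<close> let \<open>a\<close> be the sum of the squared errors of the other
  coordinates of the current point. For an exact quadratic the selected grid point would be the one
  nearest to the minimizer, at distance at most \<open>R / 30\<close>. The perturbation \<open>\<delta>\<close> lets a part of \<open>a\<close> leak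
  into the selection: the new squared error is at most
  \<open>((8 * D + 1) * (R / 30)\<^sup>2 + 2 * a) / (8 * D - 1)\<close>. If \<open>a \<le> cap D * R\<^sup>2\<close>, this is at most
  \<open>(R / 3)\<^sup>2\<close>, and then cutting the interval at distance \<open>R / 3\<close> keeps the minimizer.

  So everything rests on the inequality \<open>a \<le> cap D * R\<^sup>2\<close>, and it does not follow from the box alone:
  the current point may sit on the boundary of the box, with errors as long as the sides, and
  \<open>cap D\<close> is less than \<open>D / 2\<close>. What saves the inequality is the history of the errors. One
  sweep over the coordinates shrinks \<open>R\<^sup>2\<close> by a factor 9 at worst, because a longest side loses at most
  two thirds of its length and then rests for \<open>D\<close> steps. The squared errors, however, obey a delayed
  recursion whose new value is roughly a quarter of the average of the \<open>D\<close> preceding ones plus grid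
  noise, and such a recursion decays by a factor larger than 10 per sweep when \<open>D\<close> is large. The
  margin between 9 and this rate is small, and it also has to absorb the grid noise; this is why the
  constants below are tight.

  To turn rates into bounds, the errors within a window of \<open>d\<close> consecutive steps are compared with
  fixed profiles, scaled by \<open>9 * R\<^sup>2\<close>. A geometric profile \<open>height * decay D ^ i\<close> is reproduced by
  a sweep in which \<open>R\<^sup>2\<close> drops by 9, with something to spare for the noise (\<open>geometric_sweep\<close>). The
  start, where every error is at most half a side, corresponds to a flat profile; one sweep takes
  it below the geometric one (\<open>first_sweep\<close>). Together they give \<open>delayed_errors_bounded\<close>, a statement
  about two real sequences only. The algorithm enters through \<open>sqerr_step\<close> (the recursion), \<open>R_third\<close>
  (\<open>R\<close> drops by at most 3 per sweep) and \<open>sqerr_initial\<close>, and \<open>minimizer_in_box\<close> closes the circle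
  between containment and error bounds by induction on the steps.

  The number of sweeps is a matter of the box alone: after a sweep every interval has been cut to at
  most \<open>2 * R / 3\<close> (\<open>R_sweep_le\<close>), so the diameter decreases like \<open>(2 / 3) ^ k\<close>.
\<close>

section \<open>A geometric profile for the delayed recursion\<close>

text \<open>
  If \<open>x\<close> is the sequence of squared errors, ordered by the time of their creation, then
  \<open>x (t + D + 1) \<le> noise D * (R t)\<^sup>2 + gain D * (x (t + 1) + \<dots> + x (t + D))\<close>. The number \<open>cap D\<close> is the
  largest bound on the sum, in units of \<open>(R t)\<^sup>2\<close>, for which the right-hand side guarantees an error
  of at most \<open>R t / 3\<close>, see \<open>noise_gain_cap\<close>.
\<close>
definition noise :: "nat \<Rightarrow> real" where "noise D = (8 * real D + 1) / (900 * (8 * real D - 1))"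
definition gain :: "nat \<Rightarrow> real" where "gain D = 2 / (8 * real D - 1)"
definition cap :: "nat \<Rightarrow> real" where "cap D = (792 * real D - 101) / 1800"

text \<open>
  The ratio for which \<open>p i = decay D ^ i\<close> makes \<open>p i - gain D * (sum of p k for k < i + 9 * sum of p k for
  i < k \<le> D)\<close> independent of \<open>i\<close>: consecutive differences give
  \<open>p (i + 1) * (1 + 9 * gain D) = p i * (1 + gain D)\<close>.
\<close>
definition decay :: "nat \<Rightarrow> real" where "decay D = (8 * real D + 1) / (8 * real D + 17)"

lemma decay_bounds: "0 < decay D" "decay D < 1"
  by (auto simp: decay_def field_simps)

lemma gain_noise_pos: assumes "D \<ge> 1" shows "gain D > 0" "noise D > 0"
  using assms by (auto simp: gain_def noise_def)

lemma noise_gain_cap: assumes "D \<ge> 1" shows "noise D + gain D * cap D = 1 / 9"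
proof -
  define e where "e = 8 * real D - 1"
  have "e > 0" and D: "real D = (e + 1) / 8" using assms by (auto simp: e_def)
  show ?thesis unfolding noise_def gain_def cap_def D using \<open>e > 0\<close> by (simp add: field_simps)
qed

text \<open>
  With \<open>h = 1 / (D + 1)\<close> the claim is \<open>(8 + 9 * h) / (8 - 7 * h) \<le> exp (2 * h)\<close>. Both sides agree up to
  first order. At \<open>h = 1 / 3\<close>, that is \<open>D = 2\<close>, they differ by less than one percent, and the
  quadratic Taylor polynomial of \<open>exp (2 * h)\<close> would be too small.
\<close>
lemma decay_ge_exp:
  assumes "D \<ge> 2" shows "exp (- (2 / (real D + 1))) \<le> decay D"
proof -
  define h where "h = 1 / (real D + 1)"
  have h: "0 < h" "h \<le> 1/3" using assms by (auto simp: h_def field_simps)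
  \<comment> \<open>The fourth power of the quadratic Taylor polynomial at \<open>h / 2\<close> is accurate enough at \<open>h = 1 / 3\<close>.\<close>
  have "(1 + h/2 + (h/2)\<^sup>2/2) \<le> exp (h/2)" using h exp_lower_Taylor_quadratic[of "h/2"] by simp
  then have "(1 + h/2 + (h/2)\<^sup>2/2)^4 \<le> exp (h/2)^4" using h by (intro power_mono) auto
  also have "exp (h/2)^4 = exp (2*h)" by (simp flip: exp_of_nat_mult)
  finally have e: "(1 + h/2 + (h/2)\<^sup>2/2)^4 \<le> exp (2*h)" .
  have D: "real D = 1 / h - 1" by (simp add: h_def)
  have "8 + 9*h \<le> (8 - 7*h) * (1 + 2*h + 2*h^2 + 5/4*h^3 + h^4/2)"
  proof -
    have "(8 - 7*h) * (1 + 2*h + 2*h^2 + 5/4*h^3 + h^4/2) - (8 + 9*h)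
      = h^2 * (2 - 4*h - 19/4*h^2 - 7/2 * h^3)" by algebra
    moreover have "h^2 \<le> h/3" "h^3 \<le> h/9"
    proof -
      show "h^2 \<le> h/3" using h by (simp add: power2_eq_square)
      have "h^3 = h * h^2" by (simp add: eval_nat_numeral)
      also have "\<dots> \<le> h * (1/9)" using h power_mono[of h "1/3" 2] by (intro mult_left_mono) (auto simp: power2_eq_square)
      finally show "h^3 \<le> h/9" by simp
    qed
    then have "2 - 4*h - 19/4*h^2 - 7/2 * h^3 \<ge> 0" using h by linarith
    then have "h^2 * (2 - 4*h - 19/4*h^2 - 7/2 * h^3) \<ge> 0" by simp
    ultimately show ?thesis by linarith
  qed
  also have "\<dots> \<le> (8 - 7*h) * exp (2*h)"
  proof (rule mult_left_mono[OF order.trans[OF _ e]])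
    have "1 + 2*h + 2*h^2 + 5/4*h^3 + h^4/2 \<le> (1 + h + h^2/2 + h^3/8)^2"
    proof -
      have "(1 + h + h^2/2 + h^3/8)^2 = 1 + 2*h + 2*h^2 + 5/4*h^3 + h^4/2 + (h^5/8 + h^6/64)" by (simp add: field_simps eval_nat_numeral)
      then show ?thesis using h by simp
    qed
    also have "\<dots> \<le> ((1 + h/2 + (h/2)\<^sup>2/2)^2)^2"
    proof (rule power_mono)
      have "(1 + h/2 + (h/2)\<^sup>2/2)^2 = 1 + h + h^2/2 + h^3/8 + h^4/64" by (simp add: field_simps eval_nat_numeral)
      then show "1 + h + h^2/2 + h^3/8 \<le> (1 + h/2 + (h/2)\<^sup>2/2)^2" using h by simp
    qed (use h in auto)
    also have "\<dots> = (1 + h/2 + (h/2)\<^sup>2/2)^4" by (simp flip: power_mult)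
    finally show "1 + 2*h + 2*h^2 + 5/4*h^3 + h^4/2 \<le> (1 + h/2 + (h/2)\<^sup>2/2)^4" .
  qed (use h in auto)
  finally have "8 + 9*h \<le> (8 - 7*h) * exp (2*h)" .
  moreover have "8 * real D + 17 = (8 + 9*h)/h" "8 * real D + 1 = (8 - 7*h)/h" using h by (auto simp: D field_simps)
  then have "decay D = (8 - 7*h) / (8 + 9*h)" using h unfolding decay_def by simp
  moreover have "8 + 9*h > 0" using h by simp
  ultimately have "1 \<le> decay D * exp (2*h)" by (simp add: pos_le_divide_eq)
  then have "1 * exp (- (2*h)) \<le> decay D * exp (2*h) * exp (- (2*h))" by (rule mult_right_mono) simp
  also have "\<dots> = decay D" by (simp add: mult.assoc flip: exp_add)
  finally show ?thesis by (simp add: h_def)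
qed

text \<open>
  The scale of the geometric profile. It must be small enough for the sum of the profile to stay
  below \<open>cap D / 9\<close> (\<open>surplus_nonneg_and_total\<close>) and large enough for the profile to lie above what the
  first sweep produces (\<open>separating_line\<close>). For large \<open>D\<close> this leaves a narrow interval.
\<close>
definition height :: real where "height = 1175 / 10000"

lemma sum_split_powers:
  fixes r :: real assumes "r \<noteq> 1" "i \<le> D"
  shows "(\<Sum>k<i. r ^ k) = (1 - r ^ i) / (1 - r)"
    and "(\<Sum>k\<in>{i<..D}. r ^ k) = (r ^ Suc i - r ^ Suc D) / (1 - r)"
proof -
  have lt: "(\<Sum>k<n. r ^ k) = (1 - r ^ n) / (1 - r)" for n
    using assms by (simp add: sum_gp_strict)
  show "(\<Sum>k<i. r ^ k) = (1 - r ^ i) / (1 - r)" by (rule lt)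
  have "(\<Sum>k<Suc i. r ^ k) + (\<Sum>k\<in>{i<..D}. r ^ k) = (\<Sum>k\<in>{..<Suc i} \<union> {i<..D}. r ^ k)"
    by (rule sum.union_disjoint[symmetric]) auto
  also have "{..<Suc i} \<union> {i<..D} = {..<Suc D}" using assms by auto
  finally have "(\<Sum>k<Suc D. r ^ k) = (\<Sum>k<Suc i. r ^ k) + (\<Sum>k\<in>{i<..D}. r ^ k)" ..
  then show "(\<Sum>k\<in>{i<..D}. r ^ k) = (r ^ Suc i - r ^ Suc D) / (1 - r)"
    unfolding lt by (simp add: diff_divide_distrib)
qed

text \<open>
  During a sweep the sum in the recursion consists of the entries already renewed in this sweep
  (\<open>k < i\<close>) and of older ones (\<open>k > i\<close>). The older ones are measured by a unit \<open>R\<^sup>2\<close> that may since have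
  dropped by 9, hence the weight 9. The geometric profile reproduces itself up to a constant, which
  has the favourable sign as soon as \<open>decay D ^ (D + 1) > 1 / 9\<close>; the limit of that power is
  \<open>exp (- 2)\<close>.
\<close>
lemma decay_split_sum:
  assumes "D \<ge> 1" "i \<le> D"
  shows "gain D * ((\<Sum>k<i. decay D ^ k) + 9 * (\<Sum>k\<in>{i<..D}. decay D ^ k)) =
    decay D ^ i - (8 * real D + 17) * (9 * decay D ^ Suc D - 1) / (8 * (8 * real D - 1))"
proof -
  define e where "e = 8 * real D - 1"
  have e: "e > 0" and D: "real D = (e + 1) / 8" using assms by (auto simp: e_def)
  define a b where "a = decay D ^ i" and "b = decay D ^ Suc D"
  have r: "decay D = (e + 2) / (e + 18)" using e by (simp add: decay_def D field_simps)
  have g: "gain D = 2 / e" by (simp add: gain_def e_def)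
  have r1: "1 - decay D = 16 / (e + 18)" unfolding r using e by (simp add: field_simps)
  have ne: "decay D \<noteq> 1" using decay_bounds(2)[of D] by simp
  have "gain D * ((\<Sum>k<i. decay D ^ k) + 9 * (\<Sum>k\<in>{i<..D}. decay D ^ k)) =
     2 / e * ((1 - a) / (16 / (e + 18)) + 9 * (((e + 2) / (e + 18) * a - b) / (16 / (e + 18))))"
    unfolding sum_split_powers(1)[OF ne assms(2)] sum_split_powers(2)[OF ne assms(2)] r1 g
    by (simp add: a_def b_def r)
  also have "\<dots> = 2 / e * ((1 - a) * (e + 18) / 16 + 9 * ((e + 2) * a - b * (e + 18)) / 16)"
  proof -
    have "((e + 2) / (e + 18) * a - b) * (e + 18) = (e + 2) * a - b * (e + 18)"
      using e by (simp add: field_simps)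
    moreover have "x / (16 / (e + 18)) = x * (e + 18) / 16" for x by simp
    ultimately show ?thesis by simp
  qed
  also have "(1 - a) * (e + 18) / 16 + 9 * ((e + 2) * a - b * (e + 18)) / 16 = e * a / 2 - (e + 18) * (9 * b - 1) / 16"
    by (simp add: add_divide_distrib diff_divide_distrib algebra_simps)
  also have "2 / e * \<dots> = a - (e + 18) * (9 * b - 1) / (8 * e)"
  proof -
    have "2 / e * (e * a / 2 - z / 16) = a - z / (8 * e)" for z using e by (simp add: field_simps)
    then show ?thesis .
  qed
  finally show ?thesis by (simp add: a_def b_def e_def)
qed

lemma decay_power_ge:
  assumes "D \<ge> 2" shows "decay D ^ Suc D \<ge> 135 / 1000"
proof -
  have "exp (2::real) = exp 1 ^ 2" by (simp flip: exp_of_nat_mult)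
  also have "\<dots> \<le> (272/100)^2" using e_less_272 by (intro power_mono) auto
  also have "\<dots> \<le> 1000 / 135" by (simp add: power2_eq_square)
  finally have "135 / 1000 \<le> exp (- 2 :: real)" by (simp add: exp_minus field_simps)
  also have "exp (- 2 :: real) = exp (- (2 / (real D + 1))) ^ Suc D"
    by (subst exp_of_nat_mult[symmetric]) (simp add: field_simps)
  also have "\<dots> \<le> decay D ^ Suc D" using decay_ge_exp[OF assms] by (intro power_mono) auto
  finally show ?thesis .
qed

text \<open>The margin by which a sweep, noise included, lowers the geometric profile.\<close>
definition surplus :: "nat \<Rightarrow> real" where
  "surplus D = height * ((8 * real D + 17) * (9 * decay D ^ Suc D - 1) / (8 * (8 * real D - 1))) - noise D"

text \<open>
  The sum of the geometric profile itself may exceed \<open>cap D / 9\<close>; only the profile after a sweep, lowered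
  by the surplus in each of the \<open>D\<close> entries, satisfies the bound. Both claims reduce to linear
  inequalities in \<open>D\<close> once the power \<open>decay D ^ (D + 1)\<close> is replaced by its lower bound; \<open>D = 1\<close>, where that bound fails, is a
  computation.
\<close>
lemma surplus_nonneg_and_total:
  assumes "D \<ge> 1"
  shows "surplus D \<ge> 0"
    and "height * (\<Sum>k\<in>{0<..D}. decay D ^ k) - real D * surplus D \<le> cap D / 9"
proof -
  have *: "surplus D \<ge> 0 \<and> height * (\<Sum>k\<in>{0<..D}. decay D ^ k) - real D * surplus D \<le> cap D / 9"
  proof (cases "D = 1")
    case True
    then have "{0<..D} = {1}" by auto
    with True show ?thesis
      by (simp add: surplus_def height_def decay_def noise_def cap_def)
  next
    case False
    with assms have D: "D \<ge> 2" by simp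
    define w where "w = decay D ^ Suc D"
    have w: "w \<ge> 135/1000" using decay_power_ge[OF D] by (simp add: w_def)
    have "(8 * real D + 17) * (9 * (135/1000) - 1) \<le> (8 * real D + 17) * (9 * w - 1)"
      using w by (intro mult_left_mono) auto
    then have num: "204/100000 * (8 * real D - 1) \<le>
        height / 8 * ((8 * real D + 17) * (9 * w - 1)) - (8 * real D + 1) / 900"
      unfolding height_def by (simp add: field_simps)
    have s: "surplus D = (height / 8 * ((8 * real D + 17) * (9 * w - 1)) - (8 * real D + 1) / 900) / (8 * real D - 1)"
      using D by (simp add: surplus_def noise_def w_def diff_divide_distrib)
    then have sur: "surplus D \<ge> 204/100000"
      using num D by (simp add: pos_le_divide_eq)
    have "(\<Sum>k\<in>{0<..D}. decay D ^ k) = (decay D - w) / (1 - decay D)"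
      using decay_bounds(2)[of D] sum_split_powers(2)[of "decay D" 0 D] by (simp add: w_def)
    also have "\<dots> = (8 * real D + 1 - w * (8 * real D + 17)) / 16"
      by (simp add: decay_def field_simps)
    also have "\<dots> \<le> (8 * real D + 1 - (135/1000) * (8 * real D + 17)) / 16"
      using w by (intro divide_right_mono diff_left_mono mult_right_mono) auto
    finally have "height * (\<Sum>k\<in>{0<..D}. decay D ^ k) \<le> height * ((8 * real D + 1 - (135/1000) * (8 * real D + 17)) / 16)"
      by (rule mult_left_mono) (simp add: height_def)
    moreover have "real D * surplus D \<ge> real D * (204/100000)" using sur by (intro mult_left_mono) auto
    moreover have "real D \<ge> 2" using D by simp
    moreover have "height * z - v \<le> (792 * t - 101) / 1800 / 9"
      if "height * z \<le> height * ((8 * t + 1 - (135/1000) * (8 * t + 17)) / 16)" "t * (204/100000) \<le> v" "2 \<le> t"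
      for z v t :: real using that unfolding height_def by (simp add: field_simps)
    ultimately have "height * (\<Sum>k\<in>{0<..D}. decay D ^ k) - real D * surplus D \<le> cap D / 9"
      unfolding cap_def by blast
    with sur show ?thesis by simp
  qed
  from * show "surplus D \<ge> 0" by blast
  from * show "height * (\<Sum>k\<in>{0<..D}. decay D ^ k) - real D * surplus D \<le> cap D / 9" by blast
qed

text \<open>
  In the application \<open>\<rho>\<close> is \<open>9 * R\<^sup>2\<close> at the end of the sweep, and the second sum bounds the window
  before the sweep, which was under the same profile in its own, up to 9 times larger, unit. The sum over
  \<open>{0<..D}\<close> omits the entry 0, which belongs to the coordinate that is about to be renewed.
\<close>
lemma geometric_sweep:
  fixes y :: "nat \<Rightarrow> real"
  assumes D: "D \<ge> 1" and \<rho>: "\<rho> \<ge> 0"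
    and rec: "\<And>i. i \<le> D \<Longrightarrow>
      y i \<le> \<rho> * noise D + gain D * ((\<Sum>k<i. y k) + (\<Sum>k\<in>{i<..D}. 9 * \<rho> * (height * decay D ^ k)))"
  shows "\<forall>i\<le>D. y i \<le> \<rho> * (height * decay D ^ i)" and "(\<Sum>i\<in>{0<..D}. y i) \<le> \<rho> * (cap D / 9)"
proof -
  have sharp: "y i \<le> \<rho> * (height * decay D ^ i - surplus D)" if "i \<le> D" for i
    using that
  proof (induction i rule: less_induct)
    case (less i)
    have "(\<Sum>k<i. y k) \<le> (\<Sum>k<i. \<rho> * height * decay D ^ k)"
    proof (rule sum_mono)
      fix k assume "k \<in> {..<i}"
      then have "y k \<le> \<rho> * (height * decay D ^ k - surplus D)" using less by auto
      also have "\<dots> \<le> \<rho> * (height * decay D ^ k)"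
        using \<rho> surplus_nonneg_and_total(1)[OF D] by (intro mult_left_mono) auto
      finally show "y k \<le> \<rho> * height * decay D ^ k" by (simp add: mult.assoc)
    qed
    then have "y i \<le> \<rho> * noise D + gain D * ((\<Sum>k<i. \<rho> * height * decay D ^ k) + (\<Sum>k\<in>{i<..D}. 9 * \<rho> * (height * decay D ^ k)))"
      using rec[OF less.prems] gain_noise_pos(1)[OF D]
      by (smt (verit) mult_left_mono)
    also have "\<dots> = \<rho> * noise D + \<rho> * height * (gain D * ((\<Sum>k<i. decay D ^ k) + 9 * (\<Sum>k\<in>{i<..D}. decay D ^ k)))"
      by (simp add: sum_distrib_left algebra_simps)
    also have "\<dots> = \<rho> * (height * decay D ^ i - surplus D)"
      unfolding decay_split_sum[OF D less.prems] surplus_def by (simp add: algebra_simps)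
    finally show ?case .
  qed
  show "\<forall>i\<le>D. y i \<le> \<rho> * (height * decay D ^ i)"
    using sharp \<rho> surplus_nonneg_and_total(1)[OF D]
    by (smt (verit) mult_left_mono)
  have "(\<Sum>i\<in>{0<..D}. y i) \<le> (\<Sum>i\<in>{0<..D}. \<rho> * (height * decay D ^ i - surplus D))"
    using sharp by (intro sum_mono) auto
  also have "\<dots> = \<rho> * (height * (\<Sum>k\<in>{0<..D}. decay D ^ k) - real D * surplus D)"
    by (simp add: sum_distrib_left sum_subtractf algebra_simps)
  also have "\<dots> \<le> \<rho> * (cap D / 9)"
    using surplus_nonneg_and_total(2)[OF D] \<rho> by (intro mult_left_mono)
  finally show "(\<Sum>i\<in>{0<..D}. y i) \<le> \<rho> * (cap D / 9)" .
qed

section \<open>The first sweep\<close>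

lemma sum_line:
  fixes \<alpha> \<beta> :: real
  shows "(\<Sum>k<i. \<alpha> - \<beta> * real k) = real i * \<alpha> - \<beta> * (real i * (real i - 1) / 2)"
  by (induction i) (simp_all add: field_simps)

lemma exp_seven_fifths: "exp (7/5 :: real) \<le> 1175 / 289"
proof (rule ccontr)
  assume "\<not> ?thesis"
  then have "(1175/289 :: real) ^ 5 < exp (7/5) ^ 5" by (intro power_strict_mono) auto
  also have "\<dots> = exp 1 ^ 7" by (simp flip: exp_of_nat_mult)
  also have "\<dots> \<le> (272/100) ^ 7" using e_less_272 by (intro power_mono) auto
  finally show False by (simp add: field_simps)
qed

text \<open>
  In a sweep that starts from a flat profile the older errors are at most half the longest side at
  its start, which is at most three times the longest side \<open>R\<close> at its end. In units of \<open>9 * R\<^sup>2\<close> their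
  squares contribute \<open>1 / 4\<close> each. The profile that results is concave in \<open>i\<close>, while the geometric one is convex, and a
  straight line fits between them. The line is essentially the tangent to the geometric profile at
  \<open>i = 7 / 10 * (D + 1)\<close>, where the two come closest; it dominates the recursion, lies below the
  geometric profile, and has an average of at least \<open>1 / 36\<close> on every initial segment, where \<open>1 / 36\<close> is the bound in
  this unit for the squared error of a coordinate that has not been visited.
  For \<open>D = 1\<close>, where the estimate of \<open>decay\<close> by the exponential fails, two numbers have to be checked.
\<close>
lemma separating_line:
  assumes "D \<ge> 1"
  obtains \<alpha> \<beta> :: real where "\<beta> \<ge> 0"
    "\<And>i. i \<le> D \<Longrightarrow> noise D + gain D * ((\<Sum>k<i. \<alpha> - \<beta> * real k) + (real D - real i) / 4) \<le> \<alpha> - \<beta> * real i"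
    "\<And>i. i \<le> D \<Longrightarrow> \<alpha> - \<beta> * real i \<le> height * decay D ^ i"
    "\<And>q. q \<le> Suc D \<Longrightarrow> real q / 36 \<le> (\<Sum>k<q. \<alpha> - \<beta> * real k)"
    "(\<Sum>k\<in>{0<..D}. \<alpha> - \<beta> * real k) \<le> cap D / 9"
proof -
  have total: "(\<Sum>k\<in>{0<..D}. \<alpha> - \<beta> * real k) = real D * (\<alpha> - \<beta> * (real D + 1) / 2)" for \<alpha> \<beta> :: real
  proof -
    have "(\<Sum>k<Suc D. \<alpha> - \<beta> * real k) = (\<alpha> - \<beta> * real 0) + (\<Sum>k\<in>{0<..D}. \<alpha> - \<beta> * real k)"
      by (subst sum.remove[of _ 0]) (auto intro!: sum.cong)
    then show ?thesis unfolding sum_line by (simp add: field_simps)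
  qed
  have mean: "real q / 36 \<le> (\<Sum>k<q. \<alpha> - \<beta> * real k)"
    if "q \<le> Suc D" "\<beta> \<ge> 0" "\<alpha> - \<beta> * (real D + 1) / 2 \<ge> 1 / 36" for q and \<alpha> \<beta> :: real
  proof -
    have "\<beta> * (real q - 1) \<le> \<beta> * (real D + 1)" using that by (intro mult_left_mono) auto
    then have "1 / 36 \<le> \<alpha> - \<beta> * (real q - 1) / 2" using that by simp
    then have "real q * (1 / 36) \<le> real q * (\<alpha> - \<beta> * (real q - 1) / 2)" by (intro mult_left_mono) auto
    also have "\<dots> = (\<Sum>k<q. \<alpha> - \<beta> * real k)" unfolding sum_line by (simp add: algebra_simps)
    finally show ?thesis by simp
  qed
  show ?thesis
  proof (cases "D = 1")
    case True
    have i: "i = 0 \<or> i = 1" if "i \<le> D" for i using that True by auto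
    show ?thesis
    proof (rule that[of "4/100" "729/10000"], goal_cases)
      case (2 i)
      then show ?case using i[of i] True by (auto simp: noise_def gain_def)
    next
      case (3 i)
      then show ?case using i[of i] True by (auto simp: height_def decay_def)
    next
      case (4 q)
      then show ?case by (rule mean) (auto simp: True)
    qed (unfold total, simp_all add: True cap_def)
  next
    case False
    define m where "m = real D + 1"
    have D: "real D = m - 1" and m: "m \<ge> 3" using assms False by (auto simp: m_def)
    \<comment> \<open>The tangent at \<open>7 / 10 * m\<close> is \<open>height * exp (- 7/5) * (12/5 - 2 * i / m)\<close>;
        its leading factor is rounded down to \<open>289 / 10000\<close>.\<close>
    define b :: real where "b = 578 / 10000"
    define a :: real where "a = 6936 / 100000"
    have half: "b / m * (real D + 1) = b" using m by (simp add: m_def[symmetric])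
    show ?thesis
    proof (rule that[of "b / m" a], goal_cases)
      case 1
      then show ?case using m by (simp add: b_def)
    next
      case (2 i)
      define j where "j = real i"
      have j: "j \<ge> 0" by (simp add: j_def)
      define e where "e = 8 * m - 9"
      have e: "e > 0" using m by (simp add: e_def)
      define S where "S = j * a - b / m * (j * (j - 1) / 2) + (m - 1 - j) / 4"
      have mS: "m * S = j * a * m - b * (j * (j - 1) / 2) + m * (m - 1 - j) / 4"
        using m by (simp add: S_def field_simps)
      \<comment> \<open>After multiplication with \<open>m * e\<close> the claim is a quadratic inequality in \<open>j\<close> and \<open>m\<close>.
          Its quadratic part is only just definite, so a square is split off; the shift 2 leaves
          nonnegative terms for all \<open>m \<ge> 3\<close>.\<close>
      have "0 \<le> b * (j - 8748/10000 * m + 2)\<^sup>2 + 2312/10000 * j + (17/10000 * m^2 + 8/100 * m - 24/100)"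
        using m j power_mono[of 3 m 2] by (intro add_nonneg_nonneg) (auto simp: b_def)
      also have "\<dots> \<le> (a * m - b * j) * e - m * (8 * m - 7) / 900 - 2 * (m * S)"
      proof -
        have "(a * m - b * j) * e - m * (8 * m - 7) / 900 - 2 * (m * S)
          - (b * (j - 8748/10000 * m + 2)\<^sup>2 + 2312/10000 * j + (17/10000 * m^2 + 8/100 * m - 24/100))
          = 43/6250000 * (j * m) + 16372631/281250000000 * (m * m) + 162887/28125000 * m + 11/1250"
          unfolding mS e_def a_def b_def by (simp add: power2_eq_square field_simps)
        moreover have "0 \<le> 43/6250000 * (j * m) + 16372631/281250000000 * (m * m) + 162887/28125000 * m + 11/1250"
          using m j by (intro add_nonneg_nonneg) auto
        ultimately show ?thesis by linarith
      qed
      finally have "m * ((8 * m - 7) / 900 + 2 * S) \<le> (a * m - b * j) * e"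
        by (simp add: algebra_simps)
      also have "(a * m - b * j) * e = m * ((a - b / m * j) * e)"
        using m by (simp add: algebra_simps)
      finally have "m * ((8 * m - 7) / 900 + 2 * S) \<le> m * ((a - b / m * j) * e)" .
      then have "(8 * m - 7) / 900 + 2 * S \<le> (a - b / m * j) * e"
        using m by simp
      then have "((8 * m - 7) / 900 + 2 * S) / e \<le> a - b / m * j"
        using e by (simp add: pos_divide_le_eq)
      moreover have "noise D = (8 * m - 7) / 900 / e" "gain D = 2 / e"
        by (simp_all add: noise_def gain_def D e_def)
      ultimately show ?case
        unfolding sum_line j_def[symmetric] D S_def by (simp add: add_divide_distrib)
    next
      case (3 i)
      have "exp (7/5 - 2 * real i / m) \<ge> 12/5 - 2 * real i / m"
        using exp_ge_add_one_self[of "7/5 - 2 * real i / m"] by simp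
      moreover have "12/5 - 2 * real i / m \<ge> 0"
      proof -
        have "real i \<le> m" using 3 by (simp add: m_def)
        then show ?thesis using m by (simp add: field_simps)
      qed
      ultimately have "289/10000 * (12/5 - 2 * real i / m) \<le> height * inverse (exp (7/5)) * exp (7/5 - 2 * real i / m)"
        using exp_seven_fifths by (intro mult_mono) (auto simp: height_def field_simps)
      also have "\<dots> = height * exp (- (2 * real i / m))"
        by (simp add: mult.assoc flip: exp_minus exp_add)
      also have "exp (- (2 * real i / m)) = exp (- (2 / m)) ^ i"
        by (simp add: mult.commute flip: exp_of_nat_mult)
      also have "height * \<dots> \<le> height * decay D ^ i"
        using decay_ge_exp[of D] m unfolding m_def height_def by (intro mult_left_mono power_mono) auto
      finally show ?case by (simp add: a_def b_def)
    next
      case (4 q)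
      have "1 / 36 \<le> a - b / m * (real D + 1) / 2" unfolding half by (simp add: a_def b_def)
      moreover have "b / m \<ge> 0" using m by (simp add: b_def)
      ultimately show ?case using 4 by (intro mean) auto
    next
      case 5
      show ?case unfolding total half using m by (simp add: a_def b_def cap_def D field_simps)
    qed
  qed
qed

text \<open>
  The first \<open>q\<close> entries of the window are initial errors of coordinates that have not been visited; they
  satisfy a bound in the final unit, because their intervals are still uncut sides of the final box. If
  the line is above \<open>1 / 36\<close> on these entries, then the whole window is below the line and hence below
  the geometric profile. Otherwise the line has already fallen below \<open>1 / 36\<close> where the renewed entries
  start, and the window is flat again.
\<close>
lemma first_sweep:
  fixes y :: "nat \<Rightarrow> real"
  assumes D: "D \<ge> 1" and \<rho>: "\<rho> \<ge> 0" and q: "q \<le> Suc D"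
    and init: "\<And>i. i < q \<Longrightarrow> y i \<le> \<rho> / 36"
    and rec: "\<And>i. q \<le> i \<Longrightarrow> i \<le> D \<Longrightarrow>
      y i \<le> \<rho> * noise D + gain D * ((\<Sum>k<i. y k) + \<rho> * ((real D - real i) / 4))"
  shows "(\<forall>i\<le>D. y i \<le> \<rho> / 36) \<or>
    (\<forall>i\<le>D. y i \<le> \<rho> * (height * decay D ^ i)) \<and> (\<Sum>i\<in>{0<..D}. y i) \<le> \<rho> * (cap D / 9)"
proof -
  obtain \<alpha> \<beta> :: real where \<beta>: "\<beta> \<ge> 0"
    and super: "\<And>i. i \<le> D \<Longrightarrow> noise D + gain D * ((\<Sum>k<i. \<alpha> - \<beta> * real k) + (real D - real i) / 4) \<le> \<alpha> - \<beta> * real i"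
    and geo: "\<And>i. i \<le> D \<Longrightarrow> \<alpha> - \<beta> * real i \<le> height * decay D ^ i"
    and mean: "\<And>q. q \<le> Suc D \<Longrightarrow> real q / 36 \<le> (\<Sum>k<q. \<alpha> - \<beta> * real k)"
    and total: "(\<Sum>k\<in>{0<..D}. \<alpha> - \<beta> * real k) \<le> cap D / 9"
    using separating_line[OF D] by metis
  define G where "G i = \<alpha> - \<beta> * real i" for i
  have anti: "G j \<le> G i" if "i \<le> j" for i j
    using that \<beta> by (simp add: G_def mult_left_mono)
  have late: "y i \<le> \<rho> * G i" if "q \<le> i" "i \<le> D" for i
    using that
  proof (induction i rule: less_induct)
    case (less i)
    have split: "(\<Sum>k<i. h k) = (\<Sum>k<q. h k) + (\<Sum>k\<in>{q..<i}. h k)" for h :: "nat \<Rightarrow> real"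
      using sum.atLeastLessThan_concat[of 0 q i h] less.prems by (simp add: atLeast0LessThan)
    have "(\<Sum>k<q. y k) \<le> (\<Sum>k<q. \<rho> / 36)" using init by (intro sum_mono) auto
    also have "\<dots> = \<rho> * (real q / 36)" by simp
    also have "\<dots> \<le> \<rho> * (\<Sum>k<q. G k)" using mean[OF q] \<rho> unfolding G_def by (rule mult_left_mono)
    finally have early: "(\<Sum>k<q. y k) \<le> \<rho> * (\<Sum>k<q. G k)" .
    have "(\<Sum>k\<in>{q..<i}. y k) \<le> (\<Sum>k\<in>{q..<i}. \<rho> * G k)"
      using less by (intro sum_mono) auto
    then have "(\<Sum>k<i. y k) \<le> \<rho> * (\<Sum>k<i. G k)"
      unfolding split using early by (simp add: sum_distrib_left distrib_left)
    then have "y i \<le> \<rho> * noise D + gain D * (\<rho> * (\<Sum>k<i. G k) + \<rho> * ((real D - real i) / 4))"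
      using rec[OF less.prems] gain_noise_pos(1)[OF D] by (smt (verit) mult_left_mono)
    also have "\<dots> = \<rho> * (noise D + gain D * ((\<Sum>k<i. G k) + (real D - real i) / 4))"
      by (simp add: algebra_simps)
    also have "\<dots> \<le> \<rho> * G i"
      using super[OF less.prems(2)] \<rho> unfolding G_def by (rule mult_left_mono)
    finally show ?case .
  qed
  show ?thesis
  proof (cases "q = 0 \<or> G (q - 1) \<ge> 1 / 36")
    case True
    have all: "y i \<le> \<rho> * G i" if "i \<le> D" for i
    proof (cases "q \<le> i")
      case False
      then have "G i \<ge> 1 / 36" using True order_trans[OF _ anti[of i "q - 1"]] by fastforce
      then have "\<rho> * (1 / 36) \<le> \<rho> * G i" using \<rho> by (rule mult_left_mono)
      then show ?thesis using init[of i] False by simp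
    qed (use late that in auto)
    have "y i \<le> \<rho> * (height * decay D ^ i)" if "i \<le> D" for i
      using all[OF that] mult_left_mono[OF geo[OF that] \<rho>] by (simp add: G_def)
    moreover have "(\<Sum>i\<in>{0<..D}. y i) \<le> (\<Sum>i\<in>{0<..D}. \<rho> * G i)"
      using all by (intro sum_mono) auto
    moreover have "(\<Sum>i\<in>{0<..D}. \<rho> * G i) \<le> \<rho> * (cap D / 9)"
      using mult_left_mono[OF total \<rho>] by (simp add: G_def sum_distrib_left)
    ultimately show ?thesis by force
  next
    case False
    have "y i \<le> \<rho> / 36" if "i \<le> D" for i
    proof (cases "q \<le> i")
      case True
      then have "G i \<le> G (q - 1)" by (intro anti) simp
      then have "G i \<le> 1 / 36" using False by simp
      then have "\<rho> * G i \<le> \<rho> * (1 / 36)" using \<rho> by (rule mult_left_mono)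
      then show ?thesis using late[OF True that] by simp
    qed (use init in auto)
    then show ?thesis by blast
  qed
qed

section \<open>Boundedness along all sweeps\<close>

lemma sum_window_split:
  fixes x :: "nat \<Rightarrow> real"
  assumes "i \<le> D" "\<tau> + Suc D = t + i"
  shows "(\<Sum>j\<in>{0<..D}. x (\<tau> + j)) = (\<Sum>k<i. x (t + k)) + (\<Sum>j\<in>{0<..D - i}. x (\<tau> + j))"
proof -
  have "{0<..D} = {D - i<..D} \<union> {0<..D - i}" by auto
  then have "(\<Sum>j\<in>{0<..D}. x (\<tau> + j)) = (\<Sum>j\<in>{D - i<..D}. x (\<tau> + j)) + (\<Sum>j\<in>{0<..D - i}. x (\<tau> + j))"
    by (simp add: sum.union_disjoint)
  also have "(\<Sum>j\<in>{D - i<..D}. x (\<tau> + j)) = (\<Sum>k<i. x (t + k))"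
    by (rule sum.reindex_bij_witness[of _ "\<lambda>k. k + Suc D - i" "\<lambda>j. j + i - Suc D"])
       (use assms in \<open>auto intro!: arg_cong[of _ _ x]\<close>)
  finally show ?thesis .
qed

text \<open>
  The entries \<open>x 0, \<dots>, x D\<close> are the initial squared errors, and step \<open>t\<close> produces \<open>x (t + D + 1)\<close>. The
  invariant is that each window \<open>x t, \<dots>, x (t + D)\<close> is, in units of \<open>9 * (R t)\<^sup>2\<close>, below the flat
  profile \<open>1 / 36\<close> or below the geometric one. Windows that start at time \<open>D + 1\<close> or earlier
  consist of initial errors and errors of the first sweep. Every later window arises from the one
  exactly \<open>D + 1\<close> steps earlier, by \<open>first_sweep\<close> from a flat one and by \<open>geometric_sweep\<close> from a
  geometric one. The horizon \<open>T\<close> makes the lemma usable inside an induction that proves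
  the recursion step by step.
\<close>
lemma delayed_errors_bounded:
  fixes x R :: "nat \<Rightarrow> real"
  assumes D: "D \<ge> 1"
    and nonneg: "\<And>t. t \<le> T \<Longrightarrow> 0 \<le> R t"
    and third: "\<And>s t. s \<le> t \<Longrightarrow> t \<le> s + Suc D \<Longrightarrow> t \<le> T \<Longrightarrow> R s \<le> 3 * R t"
    and init: "\<And>j t. t \<le> j \<Longrightarrow> j \<le> D \<Longrightarrow> t \<le> T \<Longrightarrow> x j \<le> (R t)\<^sup>2 / 4"
    and rec: "\<And>t. t < T \<Longrightarrow> x (t + Suc D) \<le> noise D * (R t)\<^sup>2 + gain D * (\<Sum>j\<in>{0<..D}. x (t + j))"
  assumes "t \<le> T"
  shows "(\<Sum>j\<in>{0<..D}. x (t + j)) \<le> cap D * (R t)\<^sup>2"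
proof -
  define \<rho> where "\<rho> t = 9 * (R t)\<^sup>2" for t
  have \<rho>: "\<rho> t \<ge> 0" for t by (simp add: \<rho>_def)
  define flat where "flat t \<longleftrightarrow> (\<forall>i\<le>D. x (t + i) \<le> \<rho> t / 36)" for t
  define geom where "geom t \<longleftrightarrow> (\<forall>i\<le>D. x (t + i) \<le> \<rho> t * (height * decay D ^ i)) \<and>
    (\<Sum>i\<in>{0<..D}. x (t + i)) \<le> \<rho> t * (cap D / 9)" for t
  have R2: "(R s)\<^sup>2 \<le> \<rho> t" if "s \<le> t" "t \<le> s + Suc D" "t \<le> T" for s t
  proof -
    have "(R s)\<^sup>2 \<le> (3 * R t)\<^sup>2" using third[OF that] nonneg[of s] that by (intro power_mono) auto
    then show ?thesis by (simp add: \<rho>_def power_mult_distrib)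
  qed
  have step: "x (t + i) \<le> \<rho> t * noise D + gain D * ((\<Sum>k<i. x (t + k)) + (\<Sum>j\<in>{0<..D - i}. x (\<tau> + j)))"
    if "t \<le> T" "i \<le> D" "\<tau> + Suc D = t + i" for t i \<tau>
  proof -
    have "noise D * (R \<tau>)\<^sup>2 \<le> noise D * \<rho> t"
      using R2[of \<tau> t] gain_noise_pos(2)[OF D] that by (intro mult_left_mono) auto
    moreover have "x (t + i) \<le> noise D * (R \<tau>)\<^sup>2 + gain D * (\<Sum>j\<in>{0<..D}. x (\<tau> + j))"
      using rec[of \<tau>] that by auto
    ultimately show ?thesis
      unfolding sum_window_split[OF that(2,3)] by (simp add: mult.commute)
  qed
  have sweep1: "flat t \<or> geom t"
    if t: "t \<le> T" and q: "q \<le> Suc D" "Suc D \<le> t + q"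
      and early: "\<And>i. i < q \<Longrightarrow> x (t + i) \<le> \<rho> t / 36"
      and old: "\<And>j. t \<le> j + Suc D \<Longrightarrow> j < t \<Longrightarrow> x j \<le> \<rho> t / 4" for t q
    unfolding flat_def geom_def
  proof (rule first_sweep[OF D \<rho> q(1) early])
    fix i assume i: "q \<le> i" "i \<le> D"
    then obtain \<tau> where \<tau>: "\<tau> + Suc D = t + i" using q by (metis add.commute le_Suc_ex le_trans nat_add_left_cancel_le)
    have "(\<Sum>j\<in>{0<..D - i}. x (\<tau> + j)) \<le> (\<Sum>j\<in>{0<..D - i}. \<rho> t / 4)"
      using \<tau> i by (intro sum_mono old) auto
    also have "\<dots> = \<rho> t * ((real D - real i) / 4)" using i by (simp add: of_nat_diff)
    finally show "x (t + i) \<le> \<rho> t * noise D + gain D * ((\<Sum>k<i. x (t + k)) + \<rho> t * ((real D - real i) / 4))"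
      using step[OF t i(2) \<tau>] gain_noise_pos(1)[OF D] by (smt (verit) mult_left_mono)
  qed
  have inv: "flat t \<or> geom t" if "t \<le> T" for t
    using that
  proof (induction t rule: less_induct)
    case (less t)
    show ?case
    proof (cases "t \<le> Suc D")
      case True
      show ?thesis
      proof (rule sweep1[of t "Suc D - t"])
        fix i assume "i < Suc D - t"
        then show "x (t + i) \<le> \<rho> t / 36" using init[of t "t + i"] less.prems by (simp add: \<rho>_def)
      next
        fix j assume "j < t"
        then have "x j \<le> (R 0)\<^sup>2 / 4" using init[of 0 j] True by simp
        then show "x j \<le> \<rho> t / 4" using R2[of 0 t] True less.prems by simp
      qed (use True less.prems in auto)
    next
      case False
      then obtain s where s: "t = s + Suc D" using less_imp_add_positive by (metis add.commute le_Suc_ex nat_le_linear)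
      have sT: "s \<le> T" using s less.prems by simp
      have Rst: "(R s)\<^sup>2 \<le> \<rho> t" using R2[of s t] s less.prems by simp
      from less.IH[of s] sT s have "flat s \<or> geom s" by simp
      then show ?thesis
      proof
        assume flat: "flat s"
        show ?thesis
        proof (rule sweep1[of t 0])
          fix j assume j: "t \<le> j + Suc D" "j < t"
          then have "x (s + (j - s)) \<le> \<rho> s / 36" using flat s unfolding flat_def by (metis add.commute diff_le_mono less_Suc_eq_le add_diff_cancel_left' add_Suc_right less_diff_conv2 add_le_cancel_right)
          then show "x j \<le> \<rho> t / 4" using j s Rst by (simp add: \<rho>_def)
        qed (use s less.prems in auto)
      next
        assume geom: "geom s"
        have rec': "x (t + i) \<le> \<rho> t * noise D + gain D * ((\<Sum>k<i. x (t + k)) +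
            (\<Sum>k\<in>{i<..D}. 9 * \<rho> t * (height * decay D ^ k)))" if i: "i \<le> D" for i
        proof -
          have "(\<Sum>j\<in>{0<..D - i}. x (s + i + j)) = (\<Sum>k\<in>{i<..D}. x (s + k))"
            by (rule sum.reindex_bij_witness[of _ "\<lambda>k. k - i" "\<lambda>j. i + j"]) (use i in \<open>auto simp: add.assoc\<close>)
          also have "\<dots> \<le> (\<Sum>k\<in>{i<..D}. 9 * \<rho> t * (height * decay D ^ k))"
          proof (rule sum_mono)
            fix k assume "k \<in> {i<..D}"
            then have "x (s + k) \<le> \<rho> s * (height * decay D ^ k)" using geom by (auto simp: geom_def)
            also have "\<dots> \<le> 9 * \<rho> t * (height * decay D ^ k)"
              using Rst decay_bounds(1)[of D] by (intro mult_right_mono) (auto simp: \<rho>_def height_def)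
            finally show "x (s + k) \<le> 9 * \<rho> t * (height * decay D ^ k)" .
          qed
          finally show ?thesis
            using step[OF less.prems i, of "s + i"] s gain_noise_pos(1)[OF D] by (smt (verit) mult_left_mono add.commute add.left_commute)
        qed
        from geometric_sweep[OF D \<rho>, of "\<lambda>i. x (t + i)" t, OF rec'] show ?thesis
          unfolding geom_def by blast
      qed
    qed
  qed
  from inv[OF \<open>t \<le> T\<close>] show ?thesis
  proof
    assume "flat t"
    then have "(\<Sum>j\<in>{0<..D}. x (t + j)) \<le> (\<Sum>j\<in>{0<..D}. \<rho> t / 36)"
      by (intro sum_mono) (auto simp: flat_def)
    also have "\<dots> = real D / 4 * (R t)\<^sup>2" by (simp add: \<rho>_def)
    also have "\<dots> \<le> cap D * (R t)\<^sup>2"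
      using D by (intro mult_right_mono) (auto simp: cap_def)
    finally show ?thesis .
  next
    assume "geom t"
    then show ?thesis by (simp add: geom_def \<rho>_def mult.commute)
  qed
qed

section \<open>Runs as sequences of coordinate steps\<close>

lemma nearest_natural:
  fixes z :: real assumes "0 \<le> z" "z \<le> real n"
  obtains k where "k \<le> n" "\<bar>real k - z\<bar> \<le> 1 / 2"
proof
  have "real_of_int (round z) \<ge> z - 1/2" "real_of_int (round z) \<le> z + 1/2"
    using of_int_round_abs_le[of z] by linarith+
  moreover from this assms have "round z \<ge> 0" "round z \<le> int n" by linarith+
  ultimately show "nat (round z) \<le> n" "\<bar>real (nat (round z)) - z\<bar> \<le> 1 / 2"
    using of_int_round_abs_le[of z] by (simp_all add: le_nat_iff)
qed

lemma eucl_dist_update_square: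
  assumes "i < d"
  shows "(eucl_dist d (p(i := v)) y)\<^sup>2 = (v - y i)\<^sup>2 + (\<Sum>k\<in>{..<d} - {i}. (p k - y k)\<^sup>2)"
proof -
  have "(eucl_dist d (p(i := v)) y)\<^sup>2 = (\<Sum>k\<in>{..<d}. ((p(i := v)) k - y k)\<^sup>2)"
    by (simp add: eucl_dist_def L2_set_def sum_nonneg)
  also have "\<dots> = (v - y i)\<^sup>2 + (\<Sum>k\<in>{..<d} - {i}. ((p(i := v)) k - y k)\<^sup>2)"
    using assms by (subst sum.remove[of _ i]) auto
  also have "(\<Sum>k\<in>{..<d} - {i}. ((p(i := v)) k - y k)\<^sup>2) = (\<Sum>k\<in>{..<d} - {i}. (p k - y k)\<^sup>2)"
    by (intro sum.cong) auto
  finally show ?thesis .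
qed

lemma mod_eq_imp_dist:
  fixes a b d :: nat assumes "a mod d = b mod d" "a < b" shows "a + d \<le> b"
proof -
  have "d dvd b - a" using assms mod_eq_dvd_iff_nat[of a b d] by simp
  then have "d \<le> b - a" using assms(2) by (intro dvd_imp_le) auto
  then show ?thesis using assms(2) by simp
qed

lemma inj_on_window: "inj_on (\<lambda>j. (t + j) mod d) {..<d}" for d t :: nat
proof (rule linorder_inj_onI)
  fix i j assume *: "i < j" "j \<in> {..<d}"
  show "(t + i) mod d \<noteq> (t + j) mod d"
    using mod_eq_imp_dist[of "t + i" d "t + j"] * by auto
qed auto

lemma image_window:
  fixes d t :: nat assumes "d > 0"
  shows "(\<lambda>j. (t + j) mod d) ` {..<d} = {..<d}"
  by (rule card_subset_eq) (use assms in \<open>auto simp: card_image[OF inj_on_window]\<close>)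

lemma bij_betw_window:
  fixes D t :: nat
  shows "bij_betw (\<lambda>j. (t + j) mod Suc D) {0<..D} ({..<Suc D} - {t mod Suc D})"
proof -
  let ?g = "\<lambda>j. (t + j) mod Suc D"
  have *: "{0<..D} = {..<Suc D} - {0}" by auto
  have "?g ` {0<..D} = ?g ` {..<Suc D} - ?g ` {0}"
    unfolding * by (rule inj_on_image_set_diff[OF inj_on_window]) auto
  then show ?thesis
    unfolding bij_betw_def image_window[OF zero_less_Suc]
    using inj_on_subset[OF inj_on_window, of "{0<..D}" "Suc D" t] by fastforce
qed

text \<open>The constant 16 is the number of grid points, one more than the number of grid cells.\<close>
lemma bbs_inner_cases:
  assumes "bbs_inner d f i s qs s'"
  obtains j where "j \<le> grid_size"
    "\<And>k. k \<le> grid_size \<Longrightarrow> f ((point s)(i := grid_coord s i j)) \<le> f ((point s)(i := grid_coord s i k))"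
    "s' = bbs_update d i j s" "length qs = 16"
  using assms
proof (cases rule: bbs_inner.cases)
  case (1 j)
  have nth: "qs ! k = (point s)(i := grid_coord s i k)" if "k \<le> grid_size" for k
  proof -
    have "qs = map (\<lambda>j. (point s)(i := grid_coord s i j)) [0..<Suc grid_size]"
      using 1 by (simp only: bbs_queries_def)
    then show ?thesis using that by (simp only: nth_map length_upt) (simp del: upt_Suc)
  qed
  show ?thesis
  proof (rule that[of j])
    show j: "j \<le> grid_size" using 1 by (simp add: is_arg_min_def)
    show "f ((point s)(i := grid_coord s i j)) \<le> f ((point s)(i := grid_coord s i k))" if "k \<le> grid_size" for k
      using 1 that nth[OF that] nth[OF j] by (auto simp: is_arg_min_linorder)
    show "length qs = 16" by (simp add: 1 bbs_queries_def grid_size_def)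
  qed (use 1 in simp)
qed

lemma bbs_steps_states:
  assumes "bbs_steps d f is s qs s'"
  shows "length qs = 16 * length is \<and> (\<exists>st. st 0 = s \<and> st (length is) = s' \<and>
    (\<forall>k<length is. \<exists>qs. bbs_inner d f (is ! k) (st k) qs (st (Suc k))))"
  using assms
proof induction
  case (1 s)
  then show ?case by (auto intro: exI[of _ "\<lambda>_. s"])
next
  case (2 i s qs s' "is" qs' s'')
  from "2.IH" obtain st where st: "st 0 = s'" "st (length is) = s''"
    "\<forall>k<length is. \<exists>qs. bbs_inner d f (is ! k) (st k) qs (st (Suc k))" by blast
  have "length qs = 16" using bbs_inner_cases[OF "2.hyps"(1)] by blast
  moreover have "\<forall>k<length (i # is). \<exists>qs. bbs_inner d f ((i # is) ! k) (case_nat s st k) qs (case_nat s st (Suc k))"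
    using st "2.hyps"(1) by (auto simp: less_Suc_eq_0_disj)
  ultimately show ?case using st "2.IH" by (auto intro!: exI[of _ "case_nat s st"])
qed

text \<open>
  The error analysis compares steps of different sweeps, so the sweeps of a run are concatenated to one
  sequence of states in which step \<open>t\<close> treats coordinate \<open>t mod d\<close>.
\<close>
lemma bbs_outer_states:
  assumes "d > 0" "\<And>k. k < N \<Longrightarrow> bbs_outer d f (\<sigma> k) (Q k) (\<sigma> (Suc k))"
  obtains st where "\<And>k. k \<le> N \<Longrightarrow> st (k * d) = \<sigma> k"
    "\<And>t. t < N * d \<Longrightarrow> \<exists>qs. bbs_inner d f (t mod d) (st t) qs (st (Suc t))"
  using assms(2)
proof (induction N arbitrary: thesis)
  case 0
  show ?case by (rule 0(1)[of "\<lambda>_. \<sigma> 0"]) auto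
next
  case (Suc N)
  obtain st where st: "\<And>k. k \<le> N \<Longrightarrow> st (k * d) = \<sigma> k"
    "\<And>t. t < N * d \<Longrightarrow> \<exists>qs. bbs_inner d f (t mod d) (st t) qs (st (Suc t))"
    using Suc.IH Suc.prems(2) by (metis less_SucI)
  have "bbs_steps d f [0..<d] (\<sigma> N) (Q N) (\<sigma> (Suc N))"
    using Suc.prems(2)[of N] by (simp add: bbs_outer_def)
  from bbs_steps_states[OF this] obtain st' where st': "st' 0 = \<sigma> N" "st' d = \<sigma> (Suc N)"
    "\<And>k. k < d \<Longrightarrow> \<exists>qs. bbs_inner d f k (st' k) qs (st' (Suc k))" by auto
  define st2 where "st2 t = (if t \<le> N * d then st t else st' (t - N * d))" for t
  have late: "st2 (N * d + r) = st' r" for r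
    using st(1)[of N] st'(1) by (cases r) (auto simp: st2_def)
  show ?case
  proof (rule Suc.prems(1)[of st2])
    fix k assume "k \<le> Suc N"
    then consider "k \<le> N" | "k = Suc N" by linarith
    then show "st2 (k * d) = \<sigma> k"
    proof cases
      case 1
      then show ?thesis using st(1) by (simp add: st2_def)
    next
      case 2
      then show ?thesis using late[of d] st'(2) by (simp add: add.commute)
    qed
  next
    fix t assume t: "t < Suc N * d"
    show "\<exists>qs. bbs_inner d f (t mod d) (st2 t) qs (st2 (Suc t))"
    proof (cases "t < N * d")
      case True
      then show ?thesis using st(2)[OF True] by (simp add: st2_def)
    next
      case False
      then obtain r where r: "t = N * d + r" using le_Suc_ex by (metis not_less)
      with t have "r < d" by simp
      with st'(3)[OF this] late[of r] late[of "Suc r"] r show ?thesis by simp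
    qed
  qed
qed

section \<open>The size of the box\<close>

locale bbs_trajectory =
  fixes d T :: nat and l u xs :: "nat \<Rightarrow> real" and f :: "(nat \<Rightarrow> real) \<Rightarrow> real" and st :: "nat \<Rightarrow> bbs_state"
  assumes d: "d \<ge> 2" and xs: "xs \<in> hyperbox d l u"
    and start: "st 0 = bbs_init d l u"
    and step: "t < T \<Longrightarrow> \<exists>qs. bbs_inner d f (t mod d) (st t) qs (st (Suc t))"
begin

definition side :: "nat \<Rightarrow> nat \<Rightarrow> real" where "side t k = upper (st t) k - lower (st t) k"
definition R :: "nat \<Rightarrow> real" where "R t = max_side d (st t)"

lemma mod_d: "t mod d < d" using d by simp

lemma R_eq: "R t = Max (side t ` {..<d})"
  by (simp add: R_def max_side_def side_def[abs_def])

lemma side_le_R: "k < d \<Longrightarrow> side t k \<le> R t"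
  unfolding R_eq by (intro Max_ge) auto

lemma R_attained: obtains k where "k < d" "side t k = R t"
proof -
  have "R t \<in> side t ` {..<d}" unfolding R_eq using d by (intro Max_in) (auto simp: lessThan_empty_iff)
  then show ?thesis using that by auto
qed

lemma R_leI: "(\<And>k. k < d \<Longrightarrow> side t k \<le> r) \<Longrightarrow> R t \<le> r"
  by (metis R_attained)

lemma xs_bounds: "k < d \<Longrightarrow> l k \<le> xs k \<and> xs k \<le> u k"
  using xs by (auto simp: hyperbox_def PiE_iff)

lemma grid_coord_bounds:
  assumes "lower s i \<le> upper s i" "j \<le> grid_size"
  shows "lower s i \<le> grid_coord s i j" "grid_coord s i j \<le> upper s i"
proof -
  have "real j / 15 * (upper s i - lower s i) \<le> 1 * (upper s i - lower s i)"
    using assms by (intro mult_right_mono) (auto simp: grid_size_def)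
  then show "grid_coord s i j \<le> upper s i"
    by (simp add: grid_coord_def grid_size_def)
  show "lower s i \<le> grid_coord s i j"
    using assms by (simp add: grid_coord_def)
qed

text \<open>
  Extensionality of the point matters because membership in \<open>hyperbox\<close> includes it, and the hypothesis
  on the objective function speaks about members only.
\<close>
lemma box_invariant:
  assumes "t \<le> T"
  shows "(\<forall>k<d. l k \<le> lower (st t) k \<and> lower (st t) k \<le> point (st t) k \<and>
      point (st t) k \<le> upper (st t) k \<and> upper (st t) k \<le> u k) \<and> point (st t) \<in> extensional {..<d}"
  using assms
proof (induction t)
  case 0
  have "l k \<le> u k" if "k < d" for k using xs_bounds[OF that] by simp
  then show ?case by (simp add: start bbs_init_def field_simps extensional_def)
next
  case (Suc t)
  then have IH: "\<forall>k<d. l k \<le> lower (st t) k \<and> lower (st t) k \<le> point (st t) k \<and>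
      point (st t) k \<le> upper (st t) k \<and> upper (st t) k \<le> u k" "point (st t) \<in> extensional {..<d}" by auto
  obtain k where k: "k < d" "side t k = R t" by (rule R_attained)
  with IH(1) have "lower (st t) k \<le> upper (st t) k" by (meson order_trans)
  with k have R: "R t \<ge> 0" by (simp add: side_def)
  obtain j where j: "j \<le> grid_size" "st (Suc t) = bbs_update d (t mod d) j (st t)"
  proof -
    obtain qs where "bbs_inner d f (t mod d) (st t) qs (st (Suc t))" using step[of t] Suc.prems by auto
    then show ?thesis using that by (rule bbs_inner_cases)
  qed
  have "lower (st t) (t mod d) \<le> upper (st t) (t mod d)" using IH(1) mod_d[of t] by (meson order_trans)
  note grid = grid_coord_bounds[OF this j(1)]
  have "l k \<le> lower (st (Suc t)) k \<and> lower (st (Suc t)) k \<le> point (st (Suc t)) k \<and>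
      point (st (Suc t)) k \<le> upper (st (Suc t)) k \<and> upper (st (Suc t)) k \<le> u k" if "k < d" for k
  proof (cases "k = t mod d")
    case True
    then show ?thesis using IH(1)[rule_format, OF that] grid R
      unfolding j(2) R_def by (simp add: bbs_update_def Let_def le_max_iff_disj min_le_iff_disj)
  next
    case False
    then show ?thesis using IH(1)[rule_format, OF that]
      unfolding j(2) by (simp add: bbs_update_def Let_def)
  qed
  moreover have "point (st (Suc t)) \<in> extensional {..<d}"
    using IH(2) mod_d[of t] unfolding j(2) by (simp add: bbs_update_def Let_def extensional_def)
  ultimately show ?case by blast
qed

lemma R_nonneg:
  assumes "t \<le> T" shows "R t \<ge> 0"
proof -
  obtain k where k: "k < d" "side t k = R t" by (rule R_attained)
  with box_invariant[OF assms] have "lower (st t) k \<le> upper (st t) k" by (meson order_trans)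
  with k show ?thesis by (simp add: side_def)
qed

lemma stepE:
  assumes "t < T"
  obtains j where "j \<le> grid_size"
    "\<And>k. k \<le> grid_size \<Longrightarrow> f ((point (st t))(t mod d := grid_coord (st t) (t mod d) j))
        \<le> f ((point (st t))(t mod d := grid_coord (st t) (t mod d) k))"
    "point (st (Suc t)) = (point (st t))(t mod d := grid_coord (st t) (t mod d) j)"
    "lower (st (Suc t)) = (lower (st t))(t mod d := max (lower (st t) (t mod d)) (point (st (Suc t)) (t mod d) - R t / 3))"
    "upper (st (Suc t)) = (upper (st t))(t mod d := min (upper (st t) (t mod d)) (point (st (Suc t)) (t mod d) + R t / 3))"
proof -
  obtain qs where "bbs_inner d f (t mod d) (st t) qs (st (Suc t))" using step[OF assms] by blast
  then show ?thesis
  proof (rule bbs_inner_cases, goal_cases)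
    case (1 j)
    show ?thesis
      by (rule that[OF 1(1,2)]) (simp_all add: 1(3) bbs_update_def Let_def R_def)
  qed
qed

lemma unchanged:
  assumes "s \<le> t" "t \<le> T" "\<And>r. s \<le> r \<Longrightarrow> r < t \<Longrightarrow> r mod d \<noteq> k"
  shows "lower (st t) k = lower (st s) k \<and> upper (st t) k = upper (st s) k \<and> point (st t) k = point (st s) k"
  using assms
proof (induction t rule: dec_induct)
  case (step t)
  have "t < T" using step.prems by simp
  then show ?case
    by (rule stepE) (use step in auto)
qed simp

lemma side_antimono:
  assumes "s \<le> t" "t \<le> T" shows "side t k \<le> side s k"
  using assms
proof (induction t rule: dec_induct)
  case (step t)
  have "t < T" using step.prems by simp
  then have "side (Suc t) k \<le> side t k"
    by (rule stepE) (auto simp: side_def)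
  then show ?case using step by simp
qed simp

lemma R_antimono: "s \<le> t \<Longrightarrow> t \<le> T \<Longrightarrow> R t \<le> R s"
  by (rule R_leI) (blast intro: order_trans side_antimono side_le_R)

text \<open>
  The new interval reaches \<open>R / 3\<close> to both sides of the selected point, unless it is cut off by the old
  interval. A longest side can be cut off on one end only, so a third of it always remains.
\<close>
lemma side_after_step:
  assumes "t < T"
  shows "side (Suc t) (t mod d) \<le> 2 / 3 * R t"
    and "side t (t mod d) = R t \<Longrightarrow> R t / 3 \<le> side (Suc t) (t mod d)"
proof -
  have "lower (st t) (t mod d) \<le> upper (st t) (t mod d)"
    using assms box_invariant[of t] mod_d[of t] by (meson less_imp_le order_trans)
  note grid = grid_coord_bounds[OF this]
  have w: "lower (st t) (t mod d) \<le> point (st (Suc t)) (t mod d)" "point (st (Suc t)) (t mod d) \<le> upper (st t) (t mod d)"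
    by (rule stepE[OF assms]; use grid in simp)+
  have new: "side (Suc t) (t mod d) = min (upper (st t) (t mod d)) (point (st (Suc t)) (t mod d) + R t / 3)
      - max (lower (st t) (t mod d)) (point (st (Suc t)) (t mod d) - R t / 3)"
    by (rule stepE[OF assms]) (simp add: side_def)
  show "side (Suc t) (t mod d) \<le> 2 / 3 * R t"
    unfolding new by (simp add: min_def max_def)
  show "R t / 3 \<le> side (Suc t) (t mod d)" if "side t (t mod d) = R t"
    using that w R_nonneg[of t] assms unfolding new by (simp add: side_def min_def max_def)
qed

lemma visit:
  assumes "k < d" obtains r where "t \<le> r" "r < t + d" "r mod d = k"
proof -
  have "k \<in> (\<lambda>j. (t + j) mod d) ` {..<d}" using assms by (subst image_window) auto
  then obtain j where "j < d" "k = (t + j) mod d" by auto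
  then show ?thesis using that[of "t + j"] by simp
qed

lemma R_sweep_le:
  assumes "t + d \<le> T" shows "R (t + d) \<le> 2 / 3 * R t"
proof (rule R_leI)
  fix k assume "k < d"
  then obtain r where r: "t \<le> r" "r < t + d" "r mod d = k" by (rule visit)
  have "side (t + d) k \<le> side (Suc r) k" using r assms by (intro side_antimono) auto
  also have "\<dots> \<le> 2 / 3 * R r" using side_after_step(1)[of r] r assms by simp
  also have "\<dots> \<le> 2 / 3 * R t" using R_antimono[of t r] r assms by simp
  finally show "side (t + d) k \<le> 2 / 3 * R t" .
qed

text \<open>
  Follow one coordinate with the longest side at time \<open>s\<close>. Its interval is untouched until its next
  visit, at which \<open>R\<close> therefore still has the value \<open>R s\<close>; the visit leaves at least a third of it,
  and during the remaining steps before time \<open>s + d\<close> there is no second visit.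
\<close>
lemma R_third:
  assumes "s \<le> t" "t \<le> s + d" "t \<le> T" shows "R s \<le> 3 * R t"
proof -
  obtain k where k: "k < d" "side s k = R s" by (rule R_attained)
  obtain r where r: "s \<le> r" "r < s + d" "r mod d = k" using visit[OF k(1)] by blast
  have ne: "q mod d \<noteq> k" if "q < s + d" "s \<le> q" "q \<noteq> r" for q
    using mod_eq_imp_dist[of q d r] mod_eq_imp_dist[of r d q] that r by (cases "q < r") auto
  show ?thesis
  proof (cases "t \<le> r")
    case True
    then have "side t k = side s k"
      using unchanged[of s t k] assms ne r by (auto simp: side_def)
    then show ?thesis using side_le_R[OF k(1), of t] k R_nonneg[of t] assms by simp
  next
    case False
    have "side r k = side s k"
      using unchanged[of s r k] assms ne r False by (auto simp: side_def)
    then have "R r = R s" using side_le_R[OF k(1), of r] k R_antimono[of s r] r assms False by simp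
    then have "R s / 3 \<le> side (Suc r) k"
      using side_after_step(2)[of r] \<open>side r k = side s k\<close> k r assms False by simp
    also have "side (Suc r) k = side t k"
      using unchanged[of "Suc r" t k] assms ne r False by (auto simp: side_def)
    also have "\<dots> \<le> R t" using k(1) by (rule side_le_R)
    finally show ?thesis by simp
  qed
qed

lemma box_diameter:
  assumes "k * d \<le> T"
  shows "eucl_dist d (upper (st (k * d))) (lower (st (k * d))) \<le> real d * ((2 / 3) ^ k * R 0)"
proof -
  have "R (k * d) \<le> (2 / 3) ^ k * R 0"
    using assms
  proof (induction k)
    case (Suc k)
    then show ?case using R_sweep_le[of "k * d"] by (simp add: add.commute)
  qed simp
  then have "eucl_dist d (upper (st (k * d))) (lower (st (k * d))) \<le> (\<Sum>i\<in>{..<d}. (2 / 3) ^ k * R 0)"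
    unfolding eucl_dist_def using box_invariant[OF assms] side_le_R[of _ "k * d"]
    by (intro order_trans[OF L2_set_le_sum] sum_mono) (fastforce simp: side_def)+
  then show ?thesis by simp
qed

end

section \<open>Errors and the position of the minimizer\<close>

context bbs_trajectory
begin

text \<open>
  Errors indexed by the time of their creation: the entries below \<open>d\<close> are those of the initial midpoint,
  and step \<open>t\<close> creates entry \<open>t + d\<close>. At time \<open>t\<close> the current errors of all coordinates are then the
  entries \<open>t, \<dots>, t + d - 1\<close>.
\<close>
definition sqerr :: "nat \<Rightarrow> real" where
  "sqerr n = (if n < d then (point (st 0) n - xs n)\<^sup>2
     else (point (st (Suc (n - d))) (n mod d) - xs (n mod d))\<^sup>2)"

lemma sqerr_window:
  assumes "t \<le> T" "j < d"
  shows "(point (st t) ((t + j) mod d) - xs ((t + j) mod d))\<^sup>2 = sqerr (t + j)"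
proof (cases "t + j < d")
  case True
  have "r mod d \<noteq> t + j" if "r < t" for r using that True by simp
  then have "point (st t) (t + j) = point (st 0) (t + j)"
    using unchanged[of 0 t "t + j"] assms by blast
  then show ?thesis using True by (simp add: sqerr_def)
next
  case False
  define s where "s = t + j - d"
  have s: "s + d = t + j" "s < t" using False assms by (auto simp: s_def)
  have ne: "r mod d \<noteq> (t + j) mod d" if "Suc s \<le> r" "r < t" for r
    using mod_eq_imp_dist[of r d "t + j"] that s by auto
  have "point (st t) ((t + j) mod d) = point (st (Suc s)) ((t + j) mod d)"
    using unchanged[of "Suc s" t "(t + j) mod d"] ne s assms by simp
  then show ?thesis using False by (simp add: sqerr_def s_def)
qed

lemma sqerr_others:
  assumes "t \<le> T"
  shows "(\<Sum>k\<in>{..<d} - {t mod d}. (point (st t) k - xs k)\<^sup>2) = (\<Sum>j\<in>{0<..d - 1}. sqerr (t + j))"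
proof -
  have bij: "bij_betw (\<lambda>j. (t + j) mod d) {0<..d - 1} ({..<d} - {t mod d})"
    using bij_betw_window[of t "d - 1"] d by simp
  have "(\<Sum>k\<in>{..<d} - {t mod d}. (point (st t) k - xs k)\<^sup>2) =
      (\<Sum>j\<in>{0<..d - 1}. (point (st t) ((t + j) mod d) - xs ((t + j) mod d))\<^sup>2)"
    by (rule sum.reindex_bij_betw[OF bij, symmetric])
  also have "\<dots> = (\<Sum>j\<in>{0<..d - 1}. sqerr (t + j))"
    using assms by (intro sum.cong sqerr_window) auto
  finally show ?thesis .
qed

text \<open>
  An unvisited coordinate keeps its initial midpoint and its initial interval, which is a side of the
  box at time \<open>t\<close>. The bound in terms of the current \<open>R t\<close>, not of \<open>R 0\<close>, is essential for the windows
  of the first sweep.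
\<close>
lemma sqerr_initial:
  assumes "t \<le> j" "j < d" "t \<le> T"
  shows "sqerr j \<le> (R t)\<^sup>2 / 4"
proof -
  have "r mod d \<noteq> j" if "r < t" for r using that assms by simp
  then have "side t j = u j - l j"
    using unchanged[of 0 t j] assms by (auto simp: side_def start bbs_init_def)
  then have "u j - l j \<le> R t" using side_le_R[OF assms(2), of t] by simp
  then have "\<bar>(l j + u j) / 2 - xs j\<bar> \<le> R t / 2" using xs_bounds[OF assms(2)] by (simp add: abs_le_iff field_simps)
  then have "\<bar>(l j + u j) / 2 - xs j\<bar>\<^sup>2 \<le> (R t / 2)\<^sup>2" by (intro power_mono) auto
  then show ?thesis using assms by (simp add: sqerr_def start bbs_init_def power_divide)
qed

end

locale bbs_near_quadratic = bbs_trajectory +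
  fixes M :: real and \<delta> :: "(nat \<Rightarrow> real) \<Rightarrow> real"
  assumes M: "M > 0"
    and growth: "x \<in> hyperbox d l u \<Longrightarrow> f x - f xs = (M / 2 + \<delta> x) * (eucl_dist d x xs)\<^sup>2"
    and perturbation: "x \<in> hyperbox d l u \<Longrightarrow> \<bar>\<delta> x\<bar> \<le> M / (16 * (real d - 1))"
begin

text \<open>
  The objective lies between \<open>M / 2 - \<Delta>\<close> and \<open>M / 2 + \<Delta>\<close> times the squared distance, and with
  \<open>\<Delta> = M / (16 * D)\<close> these factors are in the ratio of \<open>8 * D - 1\<close> to \<open>8 * D + 1\<close>.
\<close>
lemma comparison:
  assumes "x \<in> hyperbox d l u" "y \<in> hyperbox d l u" "f x \<le> f y"
  shows "(8 * real (d - 1) - 1) * (eucl_dist d x xs)\<^sup>2 \<le> (8 * real (d - 1) + 1) * (eucl_dist d y xs)\<^sup>2"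
proof -
  define D where "D = real (d - 1)"
  have D: "D \<ge> 1" "real d - 1 = D" using d by (auto simp: D_def of_nat_diff)
  define \<Delta> where "\<Delta> = M / (16 * D)"
  have "(M / 2 - \<Delta>) * (eucl_dist d x xs)\<^sup>2 \<le> (M / 2 + \<delta> x) * (eucl_dist d x xs)\<^sup>2"
    using perturbation[OF assms(1)] D by (intro mult_right_mono) (auto simp: \<Delta>_def abs_le_iff)
  also have "\<dots> \<le> (M / 2 + \<delta> y) * (eucl_dist d y xs)\<^sup>2"
    using growth[OF assms(1)] growth[OF assms(2)] assms(3) by linarith
  also have "\<dots> \<le> (M / 2 + \<Delta>) * (eucl_dist d y xs)\<^sup>2"
    using perturbation[OF assms(2)] D by (intro mult_right_mono) (auto simp: \<Delta>_def abs_le_iff)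
  finally have "16 * D / M * ((M / 2 - \<Delta>) * (eucl_dist d x xs)\<^sup>2) \<le> 16 * D / M * ((M / 2 + \<Delta>) * (eucl_dist d y xs)\<^sup>2)"
    using D M by (intro mult_left_mono) auto
  moreover have "16 * D / M * (M / 2 - \<Delta>) = 8 * D - 1" "16 * D / M * (M / 2 + \<Delta>) = 8 * D + 1"
    using D M by (auto simp: \<Delta>_def field_simps)
  ultimately show ?thesis unfolding D_def[symmetric] by (simp only: mult.assoc[symmetric])
qed

text \<open>
  The selected grid point is compared with the one nearest to the minimizer, which is at distance at
  most half a grid cell because the interval contains the minimizer's coordinate.
\<close>
lemma sqerr_step:
  assumes t: "t < T" and xs_in: "lower (st t) (t mod d) \<le> xs (t mod d)" "xs (t mod d) \<le> upper (st t) (t mod d)"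
  shows "sqerr (t + d) \<le> noise (d - 1) * (R t)\<^sup>2 + gain (d - 1) * (\<Sum>j\<in>{0<..d - 1}. sqerr (t + j))"
proof -
  define i D a where "i = t mod d" and "D = real (d - 1)" and "a = (\<Sum>j\<in>{0<..d - 1}. sqerr (t + j))"
  have i: "i < d" by (simp add: i_def mod_d)
  have D: "D \<ge> 1" using d by (simp add: D_def)
  have tT: "t \<le> T" using t by simp
  have le: "lower (st t) i \<le> upper (st t) i" using xs_in by (simp add: i_def)
  obtain j where j: "j \<le> grid_size"
    "\<And>k. k \<le> grid_size \<Longrightarrow> f ((point (st t))(i := grid_coord (st t) i j)) \<le> f ((point (st t))(i := grid_coord (st t) i k))"
    "point (st (Suc t)) = (point (st t))(i := grid_coord (st t) i j)"
    using stepE[OF t] unfolding i_def by metis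
  have query: "(point (st t))(i := grid_coord (st t) i k) \<in> hyperbox d l u" if "k \<le> grid_size" for k
  proof -
    have "l n \<le> point (st t) n \<and> point (st t) n \<le> u n" if "n < d" for n
      using box_invariant[OF tT] that by (meson order_trans)
    moreover have "l i \<le> grid_coord (st t) i k \<and> grid_coord (st t) i k \<le> u i"
      using box_invariant[OF tT] i grid_coord_bounds[OF le that] by (meson order_trans)
    ultimately show ?thesis
      using box_invariant[OF tT] i unfolding hyperbox_def PiE_def by (auto simp: extensional_def)
  qed
  have dist: "(eucl_dist d ((point (st t))(i := v)) xs)\<^sup>2 = (v - xs i)\<^sup>2 + a" for v
    unfolding eucl_dist_update_square[OF i] a_def sqerr_others[OF tT, symmetric] by (simp add: i_def)
  define h where "h = side t i / 15"
  have h: "h \<ge> 0" "h \<le> R t / 15" using le side_le_R[OF i, of t] by (auto simp: h_def side_def)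
  have grid: "grid_coord (st t) i k = lower (st t) i + real k * h" for k
    by (simp add: grid_coord_def h_def side_def grid_size_def)
  obtain k where k: "k \<le> grid_size" "\<bar>grid_coord (st t) i k - xs i\<bar> \<le> R t / 30"
  proof (cases "h = 0")
    case True
    then have "side t i = 0" by (simp add: h_def)
    moreover have "grid_coord (st t) i 0 = lower (st t) i" by (simp add: grid)
    ultimately have "grid_coord (st t) i 0 - xs i = 0" using xs_in by (simp add: side_def flip: i_def)
    then show ?thesis using that[of 0] R_nonneg[OF tT] by simp
  next
    case False
    with h have "h > 0" by simp
    define z where "z = (xs i - lower (st t) i) / h"
    have "15 * h = side t i" by (simp add: h_def)
    then have "xs i \<le> lower (st t) i + 15 * h" using xs_in by (simp add: side_def i_def)
    then have "0 \<le> z" "z \<le> real 15"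
      using xs_in \<open>h > 0\<close> by (simp_all add: z_def field_simps flip: i_def)
    then obtain k where k: "k \<le> 15" "\<bar>real k - z\<bar> \<le> 1 / 2" by (rule nearest_natural)
    have "grid_coord (st t) i k - xs i = (real k - z) * h"
      using \<open>h > 0\<close> by (simp add: grid z_def field_simps)
    then have "\<bar>grid_coord (st t) i k - xs i\<bar> = \<bar>real k - z\<bar> * h" using h by (simp add: abs_mult)
    also have "\<dots> \<le> 1 / 2 * (R t / 15)" using k h by (intro mult_mono) auto
    finally show ?thesis using that[of k] k by (simp add: grid_size_def)
  qed
  have "sqerr (t + d) = (grid_coord (st t) i j - xs i)\<^sup>2"
    by (simp add: sqerr_def i_def[symmetric] j(3))
  then have "(8 * D - 1) * (sqerr (t + d) + a) \<le> (8 * D + 1) * ((grid_coord (st t) i k - xs i)\<^sup>2 + a)"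
    using comparison[OF query[OF j(1)] query[OF k(1)] j(2)[OF k(1)]] by (simp add: dist D_def)
  also have "\<dots> \<le> (8 * D + 1) * ((R t / 30)\<^sup>2 + a)"
    using power_mono[OF k(2), of 2] D by (intro mult_left_mono) auto
  finally have "(8 * D - 1) * sqerr (t + d) \<le> (8 * D + 1) * ((R t)\<^sup>2 / 900) + 2 * a"
    by (simp add: power_divide algebra_simps)
  then have "sqerr (t + d) \<le> ((8 * D + 1) * ((R t)\<^sup>2 / 900) + 2 * a) / (8 * D - 1)"
    using D by (simp add: pos_le_divide_eq mult.commute)
  also have "\<dots> = (8 * D + 1) / (900 * (8 * D - 1)) * (R t)\<^sup>2 + 2 / (8 * D - 1) * a"
    by (simp add: add_divide_distrib[of _ "2 * a"])
  finally show ?thesis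
    unfolding noise_def gain_def D_def a_def .
qed

text \<open>
  Containment up to time \<open>t\<close> validates the recursion for the steps before \<open>t\<close>, hence the bound on the
  sum of the errors at time \<open>t\<close>. By the choice of \<open>cap\<close> the next selected coordinate is then within
  \<open>R t / 3\<close> of the minimizer, and the cut keeps it.
\<close>
lemma minimizer_in_box:
  assumes "t \<le> T" "k < d"
  shows "lower (st t) k \<le> xs k \<and> xs k \<le> upper (st t) k"
proof -
  have "\<forall>s\<le>t. \<forall>k<d. lower (st s) k \<le> xs k \<and> xs k \<le> upper (st s) k" if "t \<le> T" for t
    using that
  proof (induction t)
    case 0
    then show ?case using xs_bounds by (simp add: start bbs_init_def)
  next
    case (Suc t)
    then have tT: "t \<le> T" "t < T" and IH: "\<And>s k. s \<le> t \<Longrightarrow> k < d \<Longrightarrow> lower (st s) k \<le> xs k \<and> xs k \<le> upper (st s) k"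
      by auto
    have sd: "Suc (d - 1) = d" using d by simp
    have "(\<Sum>j\<in>{0<..d - 1}. sqerr (t + j)) \<le> cap (d - 1) * (R t)\<^sup>2"
    proof (rule delayed_errors_bounded[where T = t])
      show "d - 1 \<ge> 1" using d by simp
      show "0 \<le> R a" if "a \<le> t" for a using R_nonneg that tT by simp
      show "R a \<le> 3 * R b" if "a \<le> b" "b \<le> a + Suc (d - 1)" "b \<le> t" for a b
        using R_third[of a b] that tT sd by simp
      show "sqerr j \<le> (R a)\<^sup>2 / 4" if "a \<le> j" "j \<le> d - 1" "a \<le> t" for a j
        using sqerr_initial[of a j] that tT d by simp
      show "sqerr (a + Suc (d - 1)) \<le> noise (d - 1) * (R a)\<^sup>2 + gain (d - 1) * (\<Sum>j\<in>{0<..d - 1}. sqerr (a + j))"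
        if "a < t" for a
        unfolding sd using sqerr_step[of a] IH[of a "a mod d"] that tT mod_d[of a] by simp
    qed simp
    then have "gain (d - 1) * (\<Sum>j\<in>{0<..d - 1}. sqerr (t + j)) \<le> gain (d - 1) * (cap (d - 1) * (R t)\<^sup>2)"
      by (rule mult_left_mono) (rule less_imp_le[OF gain_noise_pos(1)], use d in simp)
    moreover have "sqerr (t + d) \<le> noise (d - 1) * (R t)\<^sup>2 + gain (d - 1) * (\<Sum>j\<in>{0<..d - 1}. sqerr (t + j))"
      using sqerr_step[OF tT(2)] IH[of t "t mod d"] mod_d[of t] by simp
    ultimately have "sqerr (t + d) \<le> (noise (d - 1) + gain (d - 1) * cap (d - 1)) * (R t)\<^sup>2"
      by (simp add: algebra_simps)
    also have "\<dots> = (R t / 3)\<^sup>2"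
      using noise_gain_cap[of "d - 1"] d by (simp add: power_divide)
    finally have "(point (st (Suc t)) (t mod d) - xs (t mod d))\<^sup>2 \<le> (R t / 3)\<^sup>2"
      by (simp add: sqerr_def)
    then have "\<bar>point (st (Suc t)) (t mod d) - xs (t mod d)\<bar> \<le> R t / 3"
      using R_nonneg[OF tT(1)] abs_le_square_iff[of _ "R t / 3"] by simp
    then have near: "point (st (Suc t)) (t mod d) - R t / 3 \<le> xs (t mod d)"
      "xs (t mod d) \<le> point (st (Suc t)) (t mod d) + R t / 3" by linarith+
    have "lower (st (Suc t)) k \<le> xs k \<and> xs k \<le> upper (st (Suc t)) k" if "k < d" for k
    proof (rule stepE[OF tT(2)], goal_cases)
      case (1 j)
      then show ?case using IH[OF order_refl that] near
        unfolding 1(4,5) by (cases "k = t mod d") simp_all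
    qed
    with IH show ?case by (auto simp: le_Suc_eq)
  qed
  from this[OF assms(1)] assms(2) show ?thesis by blast
qed

end

section \<open>Counting the iterations\<close>

lemma log_bound_bigo:
  "(\<lambda>\<epsilon>::real. 1 + \<bar>C\<bar> + \<bar>log (3/2) (1/\<epsilon>)\<bar>) \<in> O[at_right 0](\<lambda>\<epsilon>. log (3/2) (1/\<epsilon>))"
proof -
  have "filterlim (\<lambda>\<epsilon>::real. ln (1/\<epsilon>)) at_top (at_right 0)"
    by (rule filterlim_compose[OF ln_at_top]) (use filterlim_inverse_at_top_right in \<open>simp add: inverse_eq_divide\<close>)
  then have "filterlim (\<lambda>\<epsilon>::real. log (3/2) (1/\<epsilon>)) at_top (at_right 0)"
    using filterlim_tendsto_pos_mult_at_top[OF tendsto_const[of "1 / ln (3/2)"]] by (simp add: log_def)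
  then have "eventually (\<lambda>\<epsilon>::real. log (3/2) (1/\<epsilon>) \<ge> 1) (at_right 0)"
    by (simp add: filterlim_at_top)
  then show ?thesis
  proof (intro bigoI[of _ "2 + \<bar>C\<bar>"], elim eventually_mono)
    fix \<epsilon> :: real assume *: "log (3/2) (1/\<epsilon>) \<ge> 1"
    then have "(1 + \<bar>C\<bar>) * 1 \<le> (1 + \<bar>C\<bar>) * log (3/2) (1/\<epsilon>)" by (intro mult_left_mono) auto
    with * show "norm (1 + \<bar>C\<bar> + \<bar>log (3/2) (1/\<epsilon>)\<bar>) \<le> (2 + \<bar>C\<bar>) * norm (log (3/2) (1/\<epsilon>))"
      by (simp add: algebra_simps)
  qed
qed

lemma bbs_run_states:
  assumes run: "bbs_run d f l u \<epsilon> \<sigma> Q" and d: "d \<ge> 2" and xs: "xs \<in> hyperbox d l u"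
    and active: "\<And>k. k < N \<Longrightarrow> bbs_continues d \<epsilon> (\<sigma> k)"
  obtains st where "bbs_trajectory d (N * d) l u xs f st" "\<And>k. k \<le> N \<Longrightarrow> st (k * d) = \<sigma> k"
proof -
  have "bbs_outer d f (\<sigma> k) (Q k) (\<sigma> (Suc k))" if "k < N" for k
    using run active[OF that] unfolding bbs_run_def by metis
  then obtain st where st: "\<And>k. k \<le> N \<Longrightarrow> st (k * d) = \<sigma> k"
    "\<And>t. t < N * d \<Longrightarrow> \<exists>qs. bbs_inner d f (t mod d) (st t) qs (st (Suc t))"
    using bbs_outer_states[of d N f \<sigma> Q] d by auto
  have "st 0 = bbs_init d l u" using st(1)[of 0] run by (simp add: bbs_run_def)
  then have "bbs_trajectory d (N * d) l u xs f st"
    using d xs st(2) by unfold_locales auto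
  then show ?thesis using that st(1) by blast
qed

theorem corollary2:
  shows "\<exists>c::real. \<forall>(d::nat) (l::nat \<Rightarrow> real) (u::nat \<Rightarrow> real). d \<ge> 2 \<longrightarrow>
    (\<exists>T::real \<Rightarrow> real. T \<in> O[at_right 0](\<lambda>\<epsilon>. log (3/2) (1/\<epsilon>)) \<and>
      (\<forall>(M::real) (f::(nat \<Rightarrow> real) \<Rightarrow> real) (\<delta>::(nat \<Rightarrow> real) \<Rightarrow> real) (xs::nat \<Rightarrow> real).
        M > 0 \<and>
        is_arg_min f (\<lambda>x. x \<in> hyperbox d l u) xs \<and>
        (\<forall>x\<in>hyperbox d l u.
          f x - f xs = (M / 2 + \<delta> x) * (eucl_dist d x xs)\<^sup>2 \<and>
          \<bar>\<delta> x\<bar> \<le> M / (16 * (real d - 1))) \<longrightarrow>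
        (\<forall>(\<epsilon>::real) \<sigma> Q. \<epsilon> > 0 \<and> bbs_run d f l u \<epsilon> \<sigma> Q \<longrightarrow>
          (\<exists>N::nat. real N \<le> T \<epsilon> \<and>
            (\<forall>k<N. bbs_continues d \<epsilon> (\<sigma> k) \<and> real (length (Q k)) \<le> c * real d) \<and>
            \<not> bbs_continues d \<epsilon> (\<sigma> N) \<and>
            xs \<in> hyperbox d (lower (\<sigma> N)) (upper (\<sigma> N))))))"
proof (intro exI[of _ 16] allI impI, goal_cases)
  case (1 d l u)
  define C where "C = real d * max_side d (bbs_init d l u) + 1"
  define T where "T \<epsilon> = 1 + \<bar>log (3/2) C\<bar> + \<bar>log (3/2) (1/\<epsilon>)\<bar>" for \<epsilon> :: real
  show ?case
  proof (intro exI[of _ T] conjI allI impI; (elim conjE)?)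
    show "T \<in> O[at_right 0](\<lambda>\<epsilon>. log (3/2) (1/\<epsilon>))"
      unfolding T_def[abs_def] by (rule log_bound_bigo)
  next
    fix M :: real and f :: "(nat \<Rightarrow> real) \<Rightarrow> real" and \<delta> :: "(nat \<Rightarrow> real) \<Rightarrow> real" and xs :: "nat \<Rightarrow> real"
      and \<epsilon> :: real and \<sigma> :: "nat \<Rightarrow> bbs_state" and Q :: "nat \<Rightarrow> (nat \<Rightarrow> real) list"
    assume M: "M > 0" and min: "is_arg_min f (\<lambda>x. x \<in> hyperbox d l u) xs"
      and growth: "\<forall>x\<in>hyperbox d l u. f x - f xs = (M / 2 + \<delta> x) * (eucl_dist d x xs)\<^sup>2 \<and>
          \<bar>\<delta> x\<bar> \<le> M / (16 * (real d - 1))"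
      and \<epsilon>: "\<epsilon> > 0" and run: "bbs_run d f l u \<epsilon> \<sigma> Q"
    have xs: "xs \<in> hyperbox d l u" using min by (simp add: is_arg_min_def)
    \<comment> \<open>If the loop is entered for the \<open>n\<close>-th time, the diameter after \<open>n - 1\<close> sweeps is at least \<open>2 * \<epsilon>\<close>.
        The summand 1 in \<open>C\<close> serves boxes that are single points, for which \<open>log\<close> would see 0.\<close>
    have bound: "real n \<le> T \<epsilon>" if active: "\<And>k. k < n \<Longrightarrow> bbs_continues d \<epsilon> (\<sigma> k)" for n
    proof (cases n)
      case 0
      then show ?thesis by (simp add: T_def)
    next
      case (Suc k)
      obtain st where tr: "bbs_trajectory d (n * d) l u xs f st" and st: "\<And>k. k \<le> n \<Longrightarrow> st (k * d) = \<sigma> k"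
        using bbs_run_states[OF run 1 xs active] by metis
      interpret bbs_trajectory d "n * d" l u xs f st by (rule tr)
      have R0: "R 0 = max_side d (bbs_init d l u)" by (simp add: R_def start)
      have C: "C \<ge> 1" using R_nonneg[of 0] by (simp add: C_def R0)
      have "2 * \<epsilon> \<le> eucl_dist d (upper (\<sigma> k)) (lower (\<sigma> k))"
        using active[of k] Suc by (simp add: bbs_continues_def)
      also have "\<dots> \<le> real d * ((2 / 3) ^ k * R 0)"
        using box_diameter[of k] st[of k] Suc by simp
      also have "\<dots> = (2 / 3) ^ k * (C - 1)" by (simp add: C_def R0)
      also have "\<dots> \<le> (2 / 3) ^ k * C" by (intro mult_left_mono) auto
      finally have "\<epsilon> \<le> (2 / 3) ^ k * C" using \<epsilon> by simp
      then have "(3 / 2) ^ k * \<epsilon> \<le> (3 / 2) ^ k * ((2 / 3) ^ k * C)" by (intro mult_left_mono) auto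
      also have "\<dots> = C" by (simp flip: power_mult_distrib mult.assoc)
      finally have "(3 / 2) ^ k \<le> C * (1 / \<epsilon>)" using \<epsilon> by (simp add: field_simps)
      then have "log (3/2) ((3 / 2) ^ k) \<le> log (3/2) (C * (1 / \<epsilon>))"
        using \<epsilon> C by (subst log_le_cancel_iff) auto
      also have "\<dots> = log (3/2) C + log (3/2) (1 / \<epsilon>)"
        using \<epsilon> C by (subst log_mult) auto
      finally have "real k \<le> log (3/2) C + log (3/2) (1 / \<epsilon>)" by (simp add: log_nat_power)
      then show ?thesis by (simp add: T_def Suc)
    qed
    define N where "N = (LEAST n. \<not> bbs_continues d \<epsilon> (\<sigma> n))"
    obtain n where "T \<epsilon> < real n" using reals_Archimedean2 by blast
    with bound[of n] have "\<exists>n. \<not> bbs_continues d \<epsilon> (\<sigma> n)" by (meson linorder_not_le)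
    then have stop: "\<not> bbs_continues d \<epsilon> (\<sigma> N)" unfolding N_def by (rule LeastI_ex)
    have active: "bbs_continues d \<epsilon> (\<sigma> k)" if "k < N" for k
      using not_less_Least[of k] that unfolding N_def by blast
    obtain st where tr: "bbs_trajectory d (N * d) l u xs f st" and st: "\<And>k. k \<le> N \<Longrightarrow> st (k * d) = \<sigma> k"
      using bbs_run_states[OF run 1 xs active] by metis
    interpret bbs_trajectory d "N * d" l u xs f st by (rule tr)
    interpret bbs_near_quadratic d "N * d" l u xs f st M \<delta>
      using M growth by unfold_locales auto
    have "xs \<in> hyperbox d (lower (\<sigma> N)) (upper (\<sigma> N))"
      using minimizer_in_box[of "N * d"] st[of N] xs by (auto simp: hyperbox_def PiE_iff)
    moreover have "real (length (Q k)) \<le> 16 * real d" if "k < N" for k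
    proof -
      have "bbs_steps d f [0..<d] (\<sigma> k) (Q k) (\<sigma> (Suc k))"
        using run active[OF that] unfolding bbs_run_def bbs_outer_def by metis
      from bbs_steps_states[OF this] show ?thesis by simp
    qed
    ultimately show "\<exists>N. real N \<le> T \<epsilon> \<and>
        (\<forall>k<N. bbs_continues d \<epsilon> (\<sigma> k) \<and> real (length (Q k)) \<le> 16 * real d) \<and>
        \<not> bbs_continues d \<epsilon> (\<sigma> N) \<and> xs \<in> hyperbox d (lower (\<sigma> N)) (upper (\<sigma> N))"
      using bound[of N] active stop by blast
  qed
qed

end
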